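(* Let $p\ge 2$ be an integer and $q=e^{i\pi/p}$. Let $A=\underline{\mathbb{C}}_{q}[x,y]$ be the divided-power quantum plane, regarded as a module over the $2p^3$-dimensional quantum group $U=\overline{\mathcal U}_{q}s\ell(2)$. For $i\ge 0$ let $A_i$ be the span of the $x^{(m)}y^{(n)}$ with $m+n=i$, and let $A_{(i)}=\bigoplus_{j=0}^{i}A_j$ be the span of the $x^{(m)}y^{(n)}$ with $0\le m+n\le i$; these are $U$-submodules. Then $A$ decomposes into $U$-representations as follows: (1) $A_{(p-1)}=\bigoplus_{r=1}^{p}\mathscr X^+_r$, where each $\mathscr X^+_r\subset A_{r-1}$; (2) $A_{(2p-1)}=A_{(p-1)}\oplus\bigoplus_{r=1}^{p-1}\mathscr W^-_r(2)\oplus 2\mathscr X^-_p$, where each $\mathscr W^-_r(2)\subset A_{p+r-1}$ and both copies of $\mathscr X^-_p$ lie in $A_{2p-1}$; (3) in general, for every $n\ge 2$, $$A_{(np-1)}=A_{((n-1)p-1)}\oplus\bigoplus_{r=1}^{p-1}\mathscr W^{\pm}_r(n)\oplus n\,\mathscr X^{\pm}_p,$$ with the $+$ sign for odd $n$ and the $-$ sign for even $n$. (Here the summands are understood up to isomorphism of $U$-modules, and $k\mathscr X$ denotes a direct sum of $k$ copies of $\mathscr X$.)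
   Context: Notation: $[n]=\frac{q^n-q^{-n}}{q-q^{-1}}$, $[n]!=[1][2]\cdots[n]$, and $\left[{m\atop n}\right]$ is the $q$-binomial coefficient $\frac{[m]!}{[m-n]!\,[n]!}$, understood as the value at $q=e^{i\pi/p}$ of the corresponding Laurent polynomial in a generic parameter. Quantum group $U=\overline{\mathcal U}_{q}s\ell(2)$: the associative $\mathbb C$-algebra generated by $E,F,K^{\pm1}$ with relations $KEK^{-1}=q^2E$, $KFK^{-1}=q^{-2}F$, $[E,F]=\frac{K-K^{-1}}{q-q^{-1}}$, $E^p=F^p=0$, $K^{2p}=1$. Divided-power quantum plane $A=\underline{\mathbb C}_q[x,y]$: the associative algebra with basis $x^{(m)}y^{(n)}$, $m,n\ge0$ (with $x^{(0)}=y^{(0)}=1$), and multiplication determined by $x^{(m)}x^{(n)}=\left[{m+n\atop m}\right]x^{(m+n)}$, $y^{(m)}y^{(n)}=\left[{m+n\atop m}\right]y^{(m+n)}$, $y^{(n)}x^{(m)}=q^{nm}x^{(m)}y^{(n)}$. The $U$-action on $A$ is $E(x^{(m)}y^{(n)})=[m+1]x^{(m+1)}y^{(n-1)}$, $K(x^{(m)}y^{(n)})=q^{m-n}x^{(m)}y^{(n)}$, $F(x^{(m)}y^{(n)})=[n+1]x^{(m-1)}y^{(n+1)}$, with $x^{(m)}=y^{(m)}=0$ for $m<0$. $U$-modules. For a sign $a=\pm1$ and $1\le r\le p$, $\mathscr X^{a}_r$ is the $r$-dimensional irreducible $U$-module with basis $v_0,\dots,v_{r-1}$ and $Kv_k=a\,q^{r-1-2k}v_k$,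 $Ev_k=a[k][r-k]v_{k-1}$ ($v_{-1}=0$), $Fv_k=v_{k+1}$ ($v_r=0$). For $1\le r\le p-1$ and $n\ge2$, $\mathscr W^{a}_r(n)$ is the indecomposable $U$-module with $n$ copies of $\mathscr X^{a}_r$ at the top and $n-1$ copies of $\mathscr X^{-a}_{p-r}$ in the socle, joined in a zigzag. Explicitly, it has basis $a^{[j]}_k$ ($1\le j\le n$, $0\le k\le r-1$), $b^{[j]}_k$ ($1\le j\le n-1$, $0\le k\le p-r-1$), with $Ka^{[j]}_k=a\,q^{r-1-2k}a^{[j]}_k$, $Kb^{[j]}_k=-a\,q^{p-r-1-2k}b^{[j]}_k$; $Ea^{[j]}_k=a[k][r-k]a^{[j]}_{k-1}$ for $k\ge1$, $Ea^{[j]}_0=b^{[j-1]}_{p-r-1}$ for $j\ge2$, $Ea^{[1]}_0=0$; $Fa^{[j]}_k=a^{[j]}_{k+1}$ for $k\le r-2$, $Fa^{[j]}_{r-1}=b^{[j]}_0$ for $j\le n-1$, $Fa^{[n]}_{r-1}=0$; $Eb^{[j]}_k=-a[k][p-r-k]b^{[j]}_{k-1}$ ($=0$ for $k=0$), $Fb^{[j]}_k=b^{[j]}_{k+1}$ for $k\le p-r-2$, $Fb^{[j]}_{p-r-1}=0$. *)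

theory Defs
  imports
    Complex_Main
    "HOL-Library.Poly_Mapping"
    "HOL-Library.FuncSet"
    "HOL-Computational_Algebra.Formal_Laurent_Series"
begin

section \<open>Complex vector spaces with a given basis\<close>

text \<open>The finitely supported functions \<open>'b \<Rightarrow>\<^sub>0 complex\<close> are the vector space with basis \<open>'b\<close>.
  Every module below is a subspace of such a space.\<close>

definition cscale :: "complex \<Rightarrow> ('b \<Rightarrow>\<^sub>0 complex) \<Rightarrow> 'b \<Rightarrow>\<^sub>0 complex"  (infixr \<open>*\<^sub>C\<close> 75)
  where "c *\<^sub>C v = Poly_Mapping.map ((*) c) v"

lemma lookup_cscale [simp]: "Poly_Mapping.lookup (c *\<^sub>C v) b = c * Poly_Mapping.lookup v b"
  by (simp add: cscale_def Poly_Mapping.map.rep_eq when_def)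

global_interpretation cvec: vector_space cscale
  by unfold_locales
    (auto intro!: poly_mapping_eqI simp: Poly_Mapping.lookup_add distrib_left distrib_right mult.assoc)

definition bvec :: "'b \<Rightarrow> 'b \<Rightarrow>\<^sub>0 complex"
  where "bvec b = Poly_Mapping.single b 1"

text \<open>\<open>linext g\<close> is the linear map that sends the basis vector \<open>bvec b\<close> to \<open>g b\<close>.\<close>

definition linext :: "('b \<Rightarrow> ('c \<Rightarrow>\<^sub>0 complex)) \<Rightarrow> ('b \<Rightarrow>\<^sub>0 complex) \<Rightarrow> 'c \<Rightarrow>\<^sub>0 complex"
  where "linext g v = (\<Sum>b\<in>Poly_Mapping.keys v. Poly_Mapping.lookup v b *\<^sub>C g b)"

definition linear_on_set ::
    "('b \<Rightarrow>\<^sub>0 complex) set \<Rightarrow> (('b \<Rightarrow>\<^sub>0 complex) \<Rightarrow> ('c \<Rightarrow>\<^sub>0 complex)) \<Rightarrow> bool"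
  where "linear_on_set S f \<longleftrightarrow>
    (\<forall>u\<in>S. \<forall>v\<in>S. f (u + v) = f u + f v) \<and> (\<forall>c. \<forall>u\<in>S. f (c *\<^sub>C u) = c *\<^sub>C f u)"

text \<open>For finite \<open>I\<close>, \<open>V\<close> is the internal direct sum of the \<open>N i\<close>: the elements of \<open>V\<close> are exactly
  the sums of the families \<open>f\<close> with \<open>f i \<in> N i\<close>, and each arises from only one such family.\<close>

definition direct_sum ::
    "('b \<Rightarrow>\<^sub>0 complex) set \<Rightarrow> 'i set \<Rightarrow> ('i \<Rightarrow> ('b \<Rightarrow>\<^sub>0 complex) set) \<Rightarrow> bool"
  where "direct_sum V I N \<longleftrightarrow> bij_betw (\<lambda>f. \<Sum>i\<in>I. f i) (Pi\<^sub>E I N) V"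

section \<open>The root of unity, q-integers and q-binomials\<close>

definition q :: "nat \<Rightarrow> complex"
  where "q p = exp (\<i> * pi / p)"

definition qint :: "nat \<Rightarrow> int \<Rightarrow> complex"
  where "qint p n = (q p powi n - q p powi (- n)) / (q p - inverse (q p))"

text \<open>At the root of unity the factorial quotient is \<open>0 / 0\<close> in general. The q-binomial is therefore
  formed in the field \<open>complex fls\<close>, whose variable is the generic parameter, and the result, a Laurent
  polynomial, is evaluated at \<open>q p\<close>.\<close>

definition gen_qint :: "nat \<Rightarrow> complex fls"
  where "gen_qint n = (fls_X ^ n - fls_X_inv ^ n) / (fls_X - fls_X_inv)"

definition gen_qfact :: "nat \<Rightarrow> complex fls"
  where "gen_qfact n = (\<Prod>k=1..n. gen_qint k)"

definition gen_qbinom :: "nat \<Rightarrow> nat \<Rightarrow> complex fls"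
  where "gen_qbinom m n = gen_qfact m / (gen_qfact (m - n) * gen_qfact n)"

definition laurent_eval :: "complex fls \<Rightarrow> complex \<Rightarrow> complex"
  where "laurent_eval f z = (\<Sum>k | fls_nth f k \<noteq> 0. fls_nth f k * z powi k)"

definition qbinom :: "nat \<Rightarrow> nat \<Rightarrow> nat \<Rightarrow> complex"
  where "qbinom p m n = laurent_eval (gen_qbinom m n) (q p)"

section \<open>Modules over the restricted quantum group of sl(2)\<close>

text \<open>The algebra is given by generators and relations, so a module over it is a vector space with
  operators for the generators \<open>E\<close>, \<open>F\<close>, \<open>K\<close>, \<open>K\<^sup>-\<^sup>1\<close> that satisfy the defining relations.\<close>

record 'b umod =
  car :: "('b \<Rightarrow>\<^sub>0 complex) set"
  actE :: "('b \<Rightarrow>\<^sub>0 complex) \<Rightarrow> 'b \<Rightarrow>\<^sub>0 complex"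
  actF :: "('b \<Rightarrow>\<^sub>0 complex) \<Rightarrow> 'b \<Rightarrow>\<^sub>0 complex"
  actK :: "('b \<Rightarrow>\<^sub>0 complex) \<Rightarrow> 'b \<Rightarrow>\<^sub>0 complex"
  actKi :: "('b \<Rightarrow>\<^sub>0 complex) \<Rightarrow> 'b \<Rightarrow>\<^sub>0 complex"

definition U_module :: "nat \<Rightarrow> ('b, 'm) umod_scheme \<Rightarrow> bool"
  where "U_module p M \<longleftrightarrow>
    cvec.subspace (car M) \<and>
    (\<forall>T \<in> {actE M, actF M, actK M, actKi M}. T ` car M \<subseteq> car M \<and> linear_on_set (car M) T) \<and>
    (\<forall>v \<in> car M.
       actK M (actKi M v) = v \<and> actKi M (actK M v) = v \<and>
       actK M (actE M (actKi M v)) = (q p)\<^sup>2 *\<^sub>C actE M v \<and>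
       actK M (actF M (actKi M v)) = inverse ((q p)\<^sup>2) *\<^sub>C actF M v \<and>
       actE M (actF M v) - actF M (actE M v) =
         inverse (q p - inverse (q p)) *\<^sub>C (actK M v - actKi M v) \<and>
       (actE M ^^ p) v = 0 \<and> (actF M ^^ p) v = 0 \<and> (actK M ^^ (2 * p)) v = v)"

definition U_submodule :: "nat \<Rightarrow> ('b, 'm) umod_scheme \<Rightarrow> ('b \<Rightarrow>\<^sub>0 complex) set \<Rightarrow> bool"
  where "U_submodule p M S \<longleftrightarrow> S \<subseteq> car M \<and> U_module p (M\<lparr>car := S\<rparr>)"

definition U_iso :: "('b, 'm) umod_scheme \<Rightarrow> ('c, 'n) umod_scheme \<Rightarrow> bool"
  where "U_iso M N \<longleftrightarrow> (\<exists>f. bij_betw f (car M) (car N) \<and> linear_on_set (car M) f \<and>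
    (\<forall>v \<in> car M. f (actE M v) = actE N (f v) \<and> f (actF M v) = actF N (f v) \<and>
                 f (actK M v) = actK N (f v) \<and> f (actKi M v) = actKi N (f v)))"

text \<open>In the next two definitions \<open>a\<close> is the sign \<open>1\<close> or \<open>-1\<close>. The vectors \<open>v\<^sub>k\<close> of
  \<open>X\<^sup>a\<^sub>r\<close> are the \<open>bvec k\<close>.\<close>

definition Xmod :: "nat \<Rightarrow> complex \<Rightarrow> nat \<Rightarrow> nat umod"
  where "Xmod p a r = \<lparr>
    car = cvec.span (bvec ` {..<r}),
    actE = linext (\<lambda>k. if k = 0 then 0 else (a * qint p k * qint p (int r - k)) *\<^sub>C bvec (k - 1)),
    actF = linext (\<lambda>k. if k + 1 < r then bvec (k + 1) else 0),
    actK = linext (\<lambda>k. (a * q p powi (int r - 1 - 2 * k)) *\<^sub>C bvec k),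
    actKi = linext (\<lambda>k. inverse (a * q p powi (int r - 1 - 2 * k)) *\<^sub>C bvec k)\<rparr>"

text \<open>\<open>Top j k\<close> and \<open>Soc j k\<close> index the vectors \<open>a\<^sup>[\<^sup>j\<^sup>]\<^sub>k\<close> and \<open>b\<^sup>[\<^sup>j\<^sup>]\<^sub>k\<close>.\<close>

datatype wbasis = Top nat nat | Soc nat nat

definition Wbasis :: "nat \<Rightarrow> nat \<Rightarrow> nat \<Rightarrow> wbasis set"
  where "Wbasis p r n = {Top j k | j k. 1 \<le> j \<and> j \<le> n \<and> k < r} \<union>
    {Soc j k | j k. 1 \<le> j \<and> j \<le> n - 1 \<and> k < p - r}"

fun WE :: "nat \<Rightarrow> complex \<Rightarrow> nat \<Rightarrow> nat \<Rightarrow> wbasis \<Rightarrow> wbasis \<Rightarrow>\<^sub>0 complex"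
  where
    "WE p a r n (Top j k) =
       (if 1 \<le> k then (a * qint p k * qint p (int r - k)) *\<^sub>C bvec (Top j (k - 1))
        else if 2 \<le> j then bvec (Soc (j - 1) (p - r - 1)) else 0)"
  | "WE p a r n (Soc j k) =
       (if 1 \<le> k then (- a * qint p k * qint p (int p - r - k)) *\<^sub>C bvec (Soc j (k - 1)) else 0)"

fun WF :: "nat \<Rightarrow> complex \<Rightarrow> nat \<Rightarrow> nat \<Rightarrow> wbasis \<Rightarrow> wbasis \<Rightarrow>\<^sub>0 complex"
  where
    "WF p a r n (Top j k) =
       (if k + 1 < r then bvec (Top j (k + 1)) else if j < n then bvec (Soc j 0) else 0)"
  | "WF p a r n (Soc j k) = (if k + 1 < p - r then bvec (Soc j (k + 1)) else 0)"

fun Wwt :: "nat \<Rightarrow> complex \<Rightarrow> nat \<Rightarrow> wbasis \<Rightarrow> complex"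
  where
    "Wwt p a r (Top j k) = a * q p powi (int r - 1 - 2 * k)"
  | "Wwt p a r (Soc j k) = - a * q p powi (int p - r - 1 - 2 * k)"

definition Wmod :: "nat \<Rightarrow> complex \<Rightarrow> nat \<Rightarrow> nat \<Rightarrow> wbasis umod"
  where "Wmod p a r n = \<lparr>
    car = cvec.span (bvec ` Wbasis p r n),
    actE = linext (WE p a r n),
    actF = linext (WF p a r n),
    actK = linext (\<lambda>b. Wwt p a r b *\<^sub>C bvec b),
    actKi = linext (\<lambda>b. inverse (Wwt p a r b) *\<^sub>C bvec b)\<rparr>"

section \<open>The divided-power quantum plane\<close>

record 'b umod_alg = "'b umod" +
  amult :: "('b \<Rightarrow>\<^sub>0 complex) \<Rightarrow> ('b \<Rightarrow>\<^sub>0 complex) \<Rightarrow> 'b \<Rightarrow>\<^sub>0 complex"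

abbreviation mon :: "nat \<Rightarrow> nat \<Rightarrow> (nat \<times> nat) \<Rightarrow>\<^sub>0 complex"
  where "mon m n \<equiv> bvec (m, n)"

text \<open>\<open>mon m n\<close> is \<open>x\<^sup>(\<^sup>m\<^sup>)y\<^sup>(\<^sup>n\<^sup>)\<close>. In a product of two of these,
  \<open>y\<^sup>(\<^sup>n\<^sup>)x\<^sup>(\<^sup>k\<^sup>) = q\<^sup>n\<^sup>kx\<^sup>(\<^sup>k\<^sup>)y\<^sup>(\<^sup>n\<^sup>)\<close> is used to reorder the
  middle factors.\<close>

definition qplane :: "nat \<Rightarrow> (nat \<times> nat) umod_alg"
  where "qplane p = \<lparr>
    car = UNIV,
    actE = linext (\<lambda>(m, n). if n = 0 then 0 else qint p (m + 1) *\<^sub>C mon (m + 1) (n - 1)),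
    actF = linext (\<lambda>(m, n). if m = 0 then 0 else qint p (n + 1) *\<^sub>C mon (m - 1) (n + 1)),
    actK = linext (\<lambda>(m, n). q p powi (int m - n) *\<^sub>C mon m n),
    actKi = linext (\<lambda>(m, n). q p powi (int n - m) *\<^sub>C mon m n),
    amult = (\<lambda>u v. linext (\<lambda>(m, n). linext (\<lambda>(k, l).
      (q p ^ (n * k) * qbinom p (m + k) m * qbinom p (n + l) n) *\<^sub>C mon (m + k) (n + l)) v) u)\<rparr>"

definition A_deg :: "nat \<Rightarrow> ((nat \<times> nat) \<Rightarrow>\<^sub>0 complex) set"
  where "A_deg i = cvec.span {mon m n | m n. m + n = i}"

definition A_upto :: "nat \<Rightarrow> ((nat \<times> nat) \<Rightarrow>\<^sub>0 complex) set"
  where "A_upto i = cvec.span {mon m n | m n. m + n \<le> i}"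

abbreviation sub_iso ::
    "nat \<Rightarrow> ((nat \<times> nat) \<Rightarrow>\<^sub>0 complex) set \<Rightarrow> 'c umod \<Rightarrow> bool"
  where "sub_iso p S N \<equiv> U_submodule p (qplane p) S \<and> U_iso ((qplane p)\<lparr>car := S\<rparr>) N"

text \<open>Labels of the summands in the decomposition of \<open>A_upto (n * p - 1)\<close>.\<close>

datatype summand = Lower | Zigzag nat | Irred nat

section \<open>The objects above are modules\<close>

lemma lookup_bvec: "Poly_Mapping.lookup (bvec b) c = (if b = c then 1 else 0)"
  by (simp add: bvec_def lookup_single when_def)

lemma linext_superset:
  assumes "finite S" "Poly_Mapping.keys v \<subseteq> S"
  shows "linext g v = (\<Sum>b\<in>S. Poly_Mapping.lookup v b *\<^sub>C g b)"
  unfolding linext_def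
  by (rule sum.mono_neutral_left) (use assms in \<open>auto simp: in_keys_iff\<close>)

lemma linext_add: "linext g (u + v) = linext g u + linext g v"
proof -
  let ?S = "Poly_Mapping.keys u \<union> Poly_Mapping.keys v"
  have "Poly_Mapping.keys (u + v) \<subseteq> ?S" by (rule Poly_Mapping.keys_add)
  then show ?thesis
    by (simp add: linext_superset[of ?S] lookup_add cvec.scale_left_distrib sum.distrib)
qed

lemma linext_scale: "linext g (c *\<^sub>C v) = c *\<^sub>C linext g v"
proof -
  have "Poly_Mapping.keys (c *\<^sub>C v) \<subseteq> Poly_Mapping.keys v" by (auto simp: in_keys_iff)
  then show ?thesis
    by (simp add: linext_superset[of "Poly_Mapping.keys v"] cvec.scale_sum_right)
qed

lemma linext_0 [simp]: "linext g 0 = 0"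
  by (simp add: linext_def)

lemma linext_diff: "linext g (u - v) = linext g u - linext g v"
  using linext_add[of g "u - v" v] by simp

lemma linext_bvec [simp]: "linext g (bvec b) = g b"
  by (simp add: linext_def bvec_def)

lemma linext_minus: "linext g (- v) = - linext g v"
  using linext_scale[of g "-1" v] by simp

lemma linear_on_set_linext: "linear_on_set S (linext g)"
  by (simp add: linear_on_set_def linext_add linext_scale)

lemma funpow_linext_0 [simp]:
  fixes g :: "'b \<Rightarrow> ('b \<Rightarrow>\<^sub>0 complex)"
  shows "(linext g ^^ n) 0 = 0"
  by (induction n) auto

lemma funpow_linext_add:
  fixes g :: "'b \<Rightarrow> ('b \<Rightarrow>\<^sub>0 complex)"
  shows "(linext g ^^ n) (u + v) = (linext g ^^ n) u + (linext g ^^ n) v"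
  by (induction n) (auto simp: linext_add)

lemma funpow_linext_scale:
  fixes g :: "'b \<Rightarrow> ('b \<Rightarrow>\<^sub>0 complex)"
  shows "(linext g ^^ n) (c *\<^sub>C v) = c *\<^sub>C (linext g ^^ n) v"
  by (induction n) (auto simp: linext_scale)

lemma funpow_linext_minus:
  fixes g :: "'b \<Rightarrow> ('b \<Rightarrow>\<^sub>0 complex)"
  shows "(linext g ^^ n) (- v) = - (linext g ^^ n) v"
  using funpow_linext_scale[of n g "-1" v] by simp

lemma linext_span:
  assumes "\<And>b. b \<in> B \<Longrightarrow> g b \<in> cvec.span (bvec ` B)" "v \<in> cvec.span (bvec ` B)"
  shows "linext g v \<in> cvec.span (bvec ` B)"
  using assms(2)
  by (induction rule: cvec.span_induct_alt)
    (auto simp: linext_add linext_scale cvec.span_zero intro!: cvec.span_add cvec.span_scale assms(1))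

lemma U_module_linextI:
  assumes car: "car M = cvec.span (bvec ` B)"
    and E: "actE M = linext gE" and F: "actF M = linext gF"
    and K: "actK M = linext (\<lambda>b. c b *\<^sub>C bvec b)"
    and Ki: "actKi M = linext (\<lambda>b. inverse (c b) *\<^sub>C bvec b)"
    and gE: "\<And>b. b \<in> B \<Longrightarrow> gE b \<in> cvec.span (bvec ` B)"
    and gF: "\<And>b. b \<in> B \<Longrightarrow> gF b \<in> cvec.span (bvec ` B)"
    and c: "\<And>b. b \<in> B \<Longrightarrow> c b ^ (2 * p) = 1" and p: "p > 0"
    and KE: "\<And>b. b \<in> B \<Longrightarrow> linext (\<lambda>b. c b *\<^sub>C bvec b) (gE b) = ((q p)\<^sup>2 * c b) *\<^sub>C gE b"
    and KF: "\<And>b. b \<in> B \<Longrightarrow> linext (\<lambda>b. c b *\<^sub>C bvec b) (gF b) = (inverse ((q p)\<^sup>2) * c b) *\<^sub>C gF b"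
    and EF: "\<And>b. b \<in> B \<Longrightarrow> linext gE (gF b) - linext gF (gE b) =
       ((c b - inverse (c b)) / (q p - inverse (q p))) *\<^sub>C bvec b"
    and Ep: "\<And>b. b \<in> B \<Longrightarrow> (linext gE ^^ p) (bvec b) = 0"
    and Fp: "\<And>b. b \<in> B \<Longrightarrow> (linext gF ^^ p) (bvec b) = 0"
  shows "U_module p M"
proof -
  let ?V = "cvec.span (bvec ` B)"
  let ?K = "linext (\<lambda>b. c b *\<^sub>C bvec b)" and ?Ki = "linext (\<lambda>b. inverse (c b) *\<^sub>C bvec b)"
  have c0: "c b \<noteq> 0" if "b \<in> B" for b
    using c[OF that] p by (auto simp: power_0_left)
  have Kpow: "(?K ^^ j) (bvec b) = (c b ^ j) *\<^sub>C bvec b" for j b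
    by (induction j) (auto simp: linext_scale mult.commute)
  note lin = linext_add linext_scale linext_diff funpow_linext_add funpow_linext_scale
  have ind [consumes 1, case_names 1 2]: "P v" if "v \<in> ?V" "P 0" "\<And>a b v. b \<in> B \<Longrightarrow> P v \<Longrightarrow> P (a *\<^sub>C bvec b + v)" for P v
    using that(1) by (induction rule: cvec.span_induct_alt) (auto intro: that)
  have K1: "?K (?Ki v) = v" "?Ki (?K v) = v" if "v \<in> ?V" for v
    using that by (induction rule: ind) (auto simp: lin c0 mult.assoc)
  have K2: "?K (linext gE (?Ki v)) = (q p)\<^sup>2 *\<^sub>C linext gE v" if "v \<in> ?V" for v
    using that by (induction rule: ind) (auto simp: lin c0 KE cvec.scale_right_distrib ac_simps)
  have K3: "?K (linext gF (?Ki v)) = inverse ((q p)\<^sup>2) *\<^sub>C linext gF v" if "v \<in> ?V" for v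
    using that by (induction rule: ind) (auto simp: lin c0 KF cvec.scale_right_distrib ac_simps)
  have K4: "linext gE (linext gF v) - linext gF (linext gE v) =
      inverse (q p - inverse (q p)) *\<^sub>C (?K v - ?Ki v)" if "v \<in> ?V" for v
    using that
  proof (induction rule: ind)
    case (2 a b v)
    have "linext gE (linext gF (a *\<^sub>C bvec b + v)) - linext gF (linext gE (a *\<^sub>C bvec b + v)) =
      a *\<^sub>C (linext gE (gF b) - linext gF (gE b)) +
      (linext gE (linext gF v) - linext gF (linext gE v))"
      by (simp add: lin cvec.scale_right_diff_distrib)
    also have "\<dots> = a *\<^sub>C (((c b - inverse (c b)) / (q p - inverse (q p))) *\<^sub>C bvec b) +
      inverse (q p - inverse (q p)) *\<^sub>C (?K v - ?Ki v)"
      using 2 by (simp only: EF)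
    also have "\<dots> = inverse (q p - inverse (q p)) *\<^sub>C
        (?K (a *\<^sub>C bvec b + v) - ?Ki (a *\<^sub>C bvec b + v))"
      by (intro poly_mapping_eqI)
        (simp add: lin lookup_add lookup_minus divide_inverse algebra_simps)
    finally show ?case .
  qed simp
  have K5: "(linext gE ^^ p) v = 0" "(linext gF ^^ p) v = 0" "(?K ^^ (2 * p)) v = v" if "v \<in> ?V" for v
    using that by (induction rule: ind) (simp_all add: lin Ep Fp Kpow c)
  have st: "linext g ` ?V \<subseteq> ?V" if "\<And>b. b \<in> B \<Longrightarrow> g b \<in> ?V" for g
    using linext_span[of B g] that by blast
  have "?K ` ?V \<subseteq> ?V" "?Ki ` ?V \<subseteq> ?V" "linext gE ` ?V \<subseteq> ?V" "linext gF ` ?V \<subseteq> ?V"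
    by (intro st; auto intro: gE gF cvec.span_scale cvec.span_base)+
  then show ?thesis
    unfolding U_module_def car E F K Ki
    using K1 K2 K3 K4 K5
    by (auto simp: linear_on_set_linext cvec.subspace_span)
qed

lemma q_nonzero [simp]: "q p \<noteq> 0"
  by (simp add: q_def)

lemma q_pow_p:
  assumes "p > 0" shows "q p ^ p = -1"
proof -
  have "q p ^ p = exp (of_nat p * (\<i> * pi / p))"
    unfolding q_def by (rule exp_of_nat_mult[symmetric])
  also have "of_nat p * (\<i> * pi / p) = \<i> * pi" using assms by simp
  finally show ?thesis by simp
qed

lemma q_powi_p: "p > 0 \<Longrightarrow> q p powi int p = -1"
  by (simp add: q_pow_p)

lemma q_diff_nonzero:
  assumes "p \<ge> 2" shows "q p - inverse (q p) \<noteq> 0"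
proof
  assume "q p - inverse (q p) = 0"
  then have "q p = inverse (q p)" by simp
  then have "Im (q p) = Im (inverse (q p))" by (rule arg_cong)
  moreover have e: "q p = cis (pi / p)" by (simp add: q_def cis_conv_exp)
  ultimately have "sin (pi / p) = 0" by (simp add: cis_inverse)
  moreover have "sin (pi / p) > 0" using assms
    by (intro sin_gt_zero) (auto simp: field_simps)
  ultimately show False by simp
qed

lemma qint_0 [simp]: "qint p 0 = 0"
  by (simp add: qint_def)

lemma qint_1 [simp]: "p \<ge> 2 \<Longrightarrow> qint p 1 = 1"
  using q_diff_nonzero[of p] by (simp add: qint_def)

lemma qint_p [simp]: "p > 0 \<Longrightarrow> qint p (int p) = 0"
  by (simp add: qint_def power_int_minus q_pow_p)

lemma qint_mult_p [simp]: "p > 0 \<Longrightarrow> qint p (int p * int k) = 0"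
  by (simp add: qint_def power_int_minus power_int_mult q_pow_p flip: power_inverse)

lemma qint_diff: 
  assumes "p \<ge> 2"
  shows "qint p (i + 1) * qint p j - qint p i * qint p (j + 1) = qint p (j - i)"
proof -
  define d x y where "d = q p - inverse (q p)" and "x = q p powi i" and "y = q p powi j"
  have [simp]: "d \<noteq> 0" "x \<noteq> 0" "y \<noteq> 0" using q_diff_nonzero[OF assms] by (auto simp: d_def x_def y_def)
  have i: "q p powi (i+1) = x * q p" "q p powi (j+1) = y * q p" "q p powi (-(i+1)) = inverse (x * q p)"
    "q p powi (-(j+1)) = inverse (y * q p)" "q p powi (-i) = inverse x" "q p powi (-j) = inverse y"
    "q p powi (j - i) = y / x" "q p powi (-(j - i)) = x / y"
    by (auto simp: x_def y_def power_int_add power_int_diff power_int_minus field_simps simp del: minus_add_distrib)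
  have "(x * q p - inverse (x * q p)) * (y - inverse y) - (x - inverse x) * (y * q p - inverse (y * q p))
     = (y / x - x / y) * d"
    by (simp add: d_def divide_inverse algebra_simps)
  then have "(x * q p - inverse (x * q p)) / d * ((y - inverse y) / d)
      - (x - inverse x) / d * ((y * q p - inverse (y * q p)) / d) = (y / x - x / y) * d / (d * d)"
    by (simp only: times_divide_times_eq diff_divide_distrib[symmetric])
  then show ?thesis
    unfolding qint_def i x_def[symmetric] y_def[symmetric] d_def[symmetric] by simp
qed

lemma q_powi_plus2: "q p powi (i + 2) = (q p)\<^sup>2 * q p powi i"
  by (simp add: power_int_add mult.commute)

lemma q_powi_minus2: "q p powi (i - 2) = inverse ((q p)\<^sup>2) * q p powi i"
  by (simp add: power_int_diff divide_inverse mult.commute)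

lemma q_powi_root:
  assumes "p > 0" shows "(q p powi i) ^ (2 * p) = 1"
proof -
  have "(q p powi i) ^ (2 * p) = (q p ^ (2 * p)) powi i"
    by (metis mult.commute power_int_mult power_int_of_nat)
  also have "q p ^ (2 * p) = (q p ^ p)\<^sup>2" by (simp add: mult.commute flip: power_mult)
  also have "\<dots> = 1" using q_pow_p[OF assms] by simp
  finally show ?thesis by simp
qed

lemma sign_wt:
  assumes "a \<in> {1, -1}"
  shows "(a * q p powi i - inverse (a * q p powi i)) / (q p - inverse (q p)) = a * qint p i"
  using assms by (auto simp: qint_def power_int_minus minus_divide_left)

lemma sign_root:
  assumes "a \<in> {1, -1}" "p > 0" shows "(a * q p powi i) ^ (2 * p) = 1"
  using assms by (auto simp: power_mult_distrib q_powi_root)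

lemma linext_bvec_id: "linext bvec v = v"
proof (rule poly_mapping_eqI)
  fix b
  have "Poly_Mapping.lookup (linext bvec v) b =
      (\<Sum>c\<in>Poly_Mapping.keys v. if c = b then Poly_Mapping.lookup v c else 0)"
    by (simp add: linext_def lookup_sum lookup_bvec if_distrib cong: if_cong)
  then show "Poly_Mapping.lookup (linext bvec v) b = Poly_Mapping.lookup v b"
    by (simp add: in_keys_iff)
qed

lemma span_bvec_UNIV: "cvec.span (range bvec) = UNIV"
proof -
  have "linext bvec v \<in> cvec.span (range bvec)" for v :: "'b \<Rightarrow>\<^sub>0 complex"
    unfolding linext_def by (intro cvec.span_sum cvec.span_scale cvec.span_base) auto
  then show ?thesis by (auto simp: linext_bvec_id)
qed

lemma qint_prod_0:
  assumes "p > 0" shows "(\<Prod>i=1..p. qint p (int m + int i)) = 0"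
proof -
  define i where "i = p - m mod p"
  have "m mod p < p" using assms by simp
  then have "i \<in> {1..p}" by (auto simp: i_def)
  moreover have "m + i = p * (m div p + 1)"
    using \<open>m mod p < p\<close> mult_div_mod_eq[of p m] unfolding i_def distrib_left by linarith
  then have "int m + int i = int p * int (m div p + 1)" by (metis of_nat_add of_nat_mult)
  then have "qint p (int m + int i) = 0" using qint_mult_p[OF assms] by metis
  ultimately show ?thesis by (intro prod_zero) auto
qed

theorem U_module_qplane:
  assumes "p \<ge> 2" shows "U_module p (qplane p)"
proof -
  define gE where "gE = (\<lambda>(m, n). if n = 0 then 0 else qint p (int (m + 1)) *\<^sub>C mon (m + 1) (n - 1))"
  define gF where "gF = (\<lambda>(m, n). if m = 0 then 0 else qint p (int (n + 1)) *\<^sub>C mon (m - 1) (n + 1))"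
  define c where "c = (\<lambda>(m, n). q p powi (int m - int n))"
  have p: "p > 0" using assms by simp
  have Ep: "(linext gE ^^ j) (mon m n) =
      (if j \<le> n then (\<Prod>i=1..j. qint p (int m + int i)) *\<^sub>C mon (m + j) (n - j) else 0)" for j m n
    by (induction j) (auto simp: gE_def linext_scale algebra_simps)
  have Fp: "(linext gF ^^ j) (mon m n) =
      (if j \<le> m then (\<Prod>i=1..j. qint p (int n + int i)) *\<^sub>C mon (m - j) (n + j) else 0)" for j m n
    by (induction j) (auto simp: gF_def linext_scale algebra_simps)
  have cE: "c (Suc m, n - Suc 0) = (q p)\<^sup>2 * c (m, n)" if "n > 0" for m n
    using that q_powi_plus2[of p "int m - int n"] by (simp add: c_def of_nat_diff algebra_simps)
  have cF: "c (m - Suc 0, Suc n) = inverse ((q p)\<^sup>2) * c (m, n)" if "m > 0" for m n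
    using that q_powi_minus2[of p "int m - int n"] by (simp add: c_def of_nat_diff algebra_simps)
  show ?thesis
  proof (rule U_module_linextI[where B = UNIV and gE = gE and gF = gF and c = c])
    show "car (qplane p) = cvec.span (range bvec)" by (simp add: qplane_def span_bvec_UNIV)
    show "actE (qplane p) = linext gE" by (simp add: qplane_def gE_def)
    show "actF (qplane p) = linext gF" by (simp add: qplane_def gF_def)
    show "actK (qplane p) = linext (\<lambda>b. c b *\<^sub>C bvec b)"
      by (simp add: qplane_def c_def case_prod_beta')
    have "inverse (c (m, n)) = q p powi (int n - int m)" for m n
      by (simp add: c_def power_int_minus[symmetric])
    then show "actKi (qplane p) = linext (\<lambda>b. inverse (c b) *\<^sub>C bvec b)"
      by (auto simp: qplane_def intro!: arg_cong[of _ _ linext])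
    show "c b ^ (2 * p) = 1" for b using p by (cases b) (simp only: c_def prod.case q_powi_root)
    show "linext (\<lambda>b. c b *\<^sub>C bvec b) (gE b) = ((q p)\<^sup>2 * c b) *\<^sub>C gE b" for b
      by (cases b) (auto simp: gE_def linext_scale cE ac_simps)
    show "linext (\<lambda>b. c b *\<^sub>C bvec b) (gF b) = (inverse ((q p)\<^sup>2) * c b) *\<^sub>C gF b" for b
      by (cases b) (auto simp: gF_def linext_scale cF ac_simps)
    show "linext gE (gF b) - linext gF (gE b) =
        ((c b - inverse (c b)) / (q p - inverse (q p))) *\<^sub>C bvec b" for b
    proof (cases b)
      case (Pair m n)
      have "linext gE (gF b) = (qint p (int n + 1) * qint p (int m)) *\<^sub>C bvec b"
        by (cases m) (auto simp: Pair gE_def gF_def linext_scale algebra_simps)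
      moreover have "linext gF (gE b) = (qint p (int n) * qint p (int m + 1)) *\<^sub>C bvec b"
        by (cases n) (auto simp: Pair gE_def gF_def linext_scale algebra_simps)
      moreover have "(c b - inverse (c b)) / (q p - inverse (q p)) = qint p (int m - int n)"
        using sign_wt[of 1 p "int m - int n"] by (simp add: c_def Pair)
      ultimately show ?thesis
        using qint_diff[OF assms, of "int n" "int m"]
        by (simp add: cvec.scale_left_diff_distrib[symmetric])
    qed
    show "(linext gE ^^ p) (bvec b) = 0" for b
      by (cases b) (simp only: Ep qint_prod_0[OF p] cvec.scale_zero_left if_cancel)
    show "(linext gF ^^ p) (bvec b) = 0" for b
      by (cases b) (simp only: Fp qint_prod_0[OF p] cvec.scale_zero_left if_cancel)
  qed (use p in \<open>auto simp: span_bvec_UNIV\<close>)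
qed

lemma funpow_linext_mono:
  fixes g :: "'b \<Rightarrow> ('b \<Rightarrow>\<^sub>0 complex)"
  assumes "(linext g ^^ i) v = 0" "i \<le> j"
  shows "(linext g ^^ j) v = 0"
proof -
  have "(linext g ^^ j) v = (linext g ^^ (j - i)) ((linext g ^^ i) v)"
    using assms(2) by (simp flip: funpow_add comp_apply[of "linext g ^^ (j - i)"])
  then show ?thesis using assms(1) by simp
qed

theorem U_module_Xmod:
  assumes "p \<ge> 2" "a \<in> {1, -1}" "1 \<le> r" "r \<le> p"
  shows "U_module p (Xmod p a r)"
proof -
  define gE where "gE = (\<lambda>k. if k = 0 then 0 else (a * qint p (int k) * qint p (int r - int k)) *\<^sub>C bvec (k - 1))"
  define gF where "gF = (\<lambda>k. if k + 1 < r then bvec (k + 1) else 0)"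
  define c where "c = (\<lambda>k. a * q p powi (int r - 1 - 2 * int k))"
  have p: "p > 0" using assms by simp
  have Ep: "(linext gE ^^ Suc k) (bvec k) = 0" for k
  proof (induction k)
    case (Suc k)
    then show ?case
      by (subst funpow_Suc_right) (simp add: gE_def funpow_linext_scale del: funpow.simps)
  qed (simp add: gE_def)
  have Fp: "(linext gF ^^ Suc j) (bvec k) = 0" if "k + Suc j \<ge> r" for j k
    using that
  proof (induction j arbitrary: k)
    case (Suc j)
    then show ?case
      by (subst funpow_Suc_right) (simp add: gF_def del: funpow.simps)
  qed (simp add: gF_def)
  have cE: "c (k - 1) = (q p)\<^sup>2 * c k" if "k > 0" for k
    using that q_powi_plus2[of p "int r - 1 - 2 * int k"] by (simp add: c_def of_nat_diff algebra_simps)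
  have cF: "c (k + 1) = inverse ((q p)\<^sup>2) * c k" for k
    using q_powi_minus2[of p "int r - 1 - 2 * int k"] by (simp add: c_def algebra_simps)
  show ?thesis
  proof (rule U_module_linextI[where B = "{..<r}" and gE = gE and gF = gF and c = c])
    show "car (Xmod p a r) = cvec.span (bvec ` {..<r})" by (simp add: Xmod_def)
    show "actE (Xmod p a r) = linext gE" by (simp add: Xmod_def gE_def)
    show "actF (Xmod p a r) = linext gF" by (simp add: Xmod_def gF_def)
    show "actK (Xmod p a r) = linext (\<lambda>b. c b *\<^sub>C bvec b)" by (simp add: Xmod_def c_def)
    show "actKi (Xmod p a r) = linext (\<lambda>b. inverse (c b) *\<^sub>C bvec b)" by (simp add: Xmod_def c_def)
    show "gE b \<in> cvec.span (bvec ` {..<r})" if "b \<in> {..<r}" for b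
      using that by (auto simp: gE_def simp: cvec.span_zero intro!: cvec.span_scale) (auto intro!: cvec.span_base)
    show "gF b \<in> cvec.span (bvec ` {..<r})" if "b \<in> {..<r}" for b
      using that by (auto simp: gF_def simp: cvec.span_zero intro!: cvec.span_scale) (auto intro!: cvec.span_base)
    show "c b ^ (2 * p) = 1" for b using assms p by (simp only: c_def sign_root)
    show "linext (\<lambda>b. c b *\<^sub>C bvec b) (gE b) = ((q p)\<^sup>2 * c b) *\<^sub>C gE b" for b
      using cE[of b] by (auto simp: gE_def linext_scale ac_simps)
    show "linext (\<lambda>b. c b *\<^sub>C bvec b) (gF b) = (inverse ((q p)\<^sup>2) * c b) *\<^sub>C gF b" for b
      using cF[of b] by (auto simp: gF_def linext_scale ac_simps)
    show "linext gE (gF k) - linext gF (gE k) =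
        ((c k - inverse (c k)) / (q p - inverse (q p))) *\<^sub>C bvec k" if "k \<in> {..<r}" for k
    proof -
      have "linext gE (gF k) = (a * (qint p (int k + 1) * qint p (int r - 1 - int k))) *\<^sub>C bvec k"
      proof (cases "k + 1 < r")
        case False
        then have "int r - 1 - int k = 0" using that by simp
        then show ?thesis using False by (simp add: gF_def)
      qed (simp add: gE_def gF_def algebra_simps)
      moreover have "linext gF (gE k) = (a * (qint p (int k) * qint p (int r - int k))) *\<^sub>C bvec k"
        using that by (auto simp: gE_def gF_def linext_scale algebra_simps)
      moreover have "(c k - inverse (c k)) / (q p - inverse (q p)) = a * qint p (int r - 1 - 2 * int k)"
        using sign_wt[OF assms(2)] by (simp add: c_def)
      ultimately show ?thesis
        using qint_diff[OF assms(1), of "int k" "int r - 1 - int k"]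
        by (simp add: cvec.scale_left_diff_distrib[symmetric] right_diff_distrib[symmetric])
    qed
    show "(linext gE ^^ p) (bvec b) = 0" if "b \<in> {..<r}" for b
      by (rule funpow_linext_mono[OF Ep]) (use that assms in auto)
    show "(linext gF ^^ p) (bvec b) = 0" if "b \<in> {..<r}" for b
      using Fp[of b "p - 1"] that assms by (simp del: funpow.simps)
  qed (use p in auto)
qed

theorem U_module_Wmod:
  assumes "p \<ge> 2" "a \<in> {1, -1}" "1 \<le> r" "r \<le> p - 1"
  shows "U_module p (Wmod p a r n)"
proof -
  let ?gE = "WE p a r n" and ?gF = "WF p a r n" and ?c = "Wwt p a r"
  have p: "p > 0" and r: "r < p" using assms by auto
  have na: "- a \<in> {1, -1}" using assms(2) by auto
  have EpS: "(linext ?gE ^^ Suc k) (bvec (Soc j k)) = 0" for j k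
  proof (induction k)
    case (Suc k)
    then show ?case
      by (subst funpow_Suc_right) (simp add: funpow_linext_scale funpow_linext_minus del: funpow.simps)
  qed simp
  have EpT: "(linext ?gE ^^ (p - r + Suc k)) (bvec (Top j k)) = 0" for j k
  proof (induction k)
    case 0
    have "(linext ?gE ^^ (p - r)) (bvec (Soc (j - 1) (p - r - 1))) = 0"
      using EpS[of "p - r - 1" "j - 1"] r by (simp only: Suc_diff_1 zero_less_diff)
    then show ?case
      unfolding add_Suc_right by (subst funpow_Suc_right) (simp del: funpow.simps)
  next
    case (Suc k)
    then show ?case
      unfolding add_Suc_right[of _ "Suc k"]
      by (subst funpow_Suc_right) (simp add: funpow_linext_scale funpow_linext_minus del: funpow.simps)
  qed
  have FpS: "(linext ?gF ^^ Suc i) (bvec (Soc j k)) = 0" if "k + Suc i \<ge> p - r" for i j k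
    using that
  proof (induction i arbitrary: k)
    case (Suc i)
    then show ?case
      by (subst funpow_Suc_right) (simp del: funpow.simps)
  qed simp
  have FpT: "(linext ?gF ^^ Suc i) (bvec (Top j k)) = 0" if "k < r" "k + Suc i \<ge> p" for i j k
    using that
  proof (induction i arbitrary: k)
    case 0
    then show ?case using r by simp
  next
    case (Suc i)
    show ?case
    proof (cases "k + 1 < r")
      case True
      then show ?thesis using Suc.IH[of "k + 1"] Suc.prems
        by (subst funpow_Suc_right) (simp del: funpow.simps)
    next
      case False
      then have "(linext ?gF ^^ Suc i) (bvec (Soc j 0)) = 0"
        using Suc.prems by (intro FpS) simp
      then show ?thesis using False
        by (subst funpow_Suc_right) (simp del: funpow.simps)
    qed
  qed
  have cT: "?c (Top j (k - 1)) = (q p)\<^sup>2 * ?c (Top j k)" if "k > 0" for j k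
    using that q_powi_plus2[of p "int r - 1 - 2 * int k"] by (simp add: of_nat_diff algebra_simps)
  have cS: "?c (Soc j (k - 1)) = (q p)\<^sup>2 * ?c (Soc j k)" if "k > 0" for j k
    using that q_powi_plus2[of p "int p - int r - 1 - 2 * int k"] by (simp add: of_nat_diff algebra_simps)
  have cTS: "?c (Soc i (p - r - 1)) = (q p)\<^sup>2 * ?c (Top j 0)" for i j
  proof -
    have "int p - int r - 1 - 2 * int (p - r - 1) = (int r - 1 + 2) - int p"
      using r by (simp add: of_nat_diff)
    then have "q p powi (int p - int r - 1 - 2 * int (p - r - 1)) =
        q p powi (int r - 1 + 2) / q p powi int p"
      by (simp only: power_int_diff q_nonzero simp_thms)
    also have "\<dots> = - ((q p)\<^sup>2 * q p powi (int r - 1))"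
      by (simp only: q_powi_plus2 q_powi_p[OF p]) simp
    finally show ?thesis by simp
  qed
  have cTF: "?c (Soc i 0) = inverse ((q p)\<^sup>2) * ?c (Top j (r - 1))" for i j
  proof -
    have "int p - int r - 1 - 2 * int 0 = int p + (int r - 1 - 2 * int (r - 1) - 2)"
      using assms by (simp add: of_nat_diff)
    then have "q p powi (int p - int r - 1 - 2 * int 0) =
        q p powi int p * q p powi (int r - 1 - 2 * int (r - 1) - 2)"
      by (simp only: power_int_add q_nonzero simp_thms)
    also have "\<dots> = - (inverse ((q p)\<^sup>2) * q p powi (int r - 1 - 2 * int (r - 1)))"
      by (simp only: q_powi_minus2 q_powi_p[OF p]) simp
    finally show ?thesis by simp
  qed
  have sp: "d *\<^sub>C bvec b \<in> cvec.span (bvec ` Wbasis p r n)" "bvec b \<in> cvec.span (bvec ` Wbasis p r n)"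
    if "b \<in> Wbasis p r n" for b d
    using that by (auto intro: cvec.span_scale cvec.span_base)
  show ?thesis
  proof (rule U_module_linextI[where B = "Wbasis p r n" and gE = ?gE and gF = ?gF and c = ?c])
    show "car (Wmod p a r n) = cvec.span (bvec ` Wbasis p r n)" by (simp add: Wmod_def)
    show "actE (Wmod p a r n) = linext ?gE" by (simp add: Wmod_def)
    show "actF (Wmod p a r n) = linext ?gF" by (simp add: Wmod_def)
    show "actK (Wmod p a r n) = linext (\<lambda>b. ?c b *\<^sub>C bvec b)" by (simp add: Wmod_def)
    show "actKi (Wmod p a r n) = linext (\<lambda>b. inverse (?c b) *\<^sub>C bvec b)" by (simp add: Wmod_def)
    show "?gE b \<in> cvec.span (bvec ` Wbasis p r n)" if "b \<in> Wbasis p r n" for b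
      using that r by (cases b)
        (auto simp: cvec.span_zero intro!: cvec.span_neg sp, auto simp: Wbasis_def)
    show "?gF b \<in> cvec.span (bvec ` Wbasis p r n)" if "b \<in> Wbasis p r n" for b
      using that r by (cases b)
        (auto simp: cvec.span_zero intro!: cvec.span_neg sp, auto simp: Wbasis_def)
    show "?c b ^ (2 * p) = 1" for b
      by (cases b) (simp_all only: Wwt.simps sign_root assms(2) na p)
    show "linext (\<lambda>b. ?c b *\<^sub>C bvec b) (?gE b) = ((q p)\<^sup>2 * ?c b) *\<^sub>C ?gE b" for b
    proof (cases b)
      case (Top j k)
      then show ?thesis using cT[of k j] cTS[of "j - 1" j]
        by (cases k) (auto simp: linext_scale linext_minus ac_simps simp del: Wwt.simps)
    next
      case (Soc j k)
      then show ?thesis using cS[of k j] by (auto simp: linext_scale linext_minus ac_simps simp del: Wwt.simps)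
    qed
    show "linext (\<lambda>b. ?c b *\<^sub>C bvec b) (?gF b) = (inverse ((q p)\<^sup>2) * ?c b) *\<^sub>C ?gF b"
      if "b \<in> Wbasis p r n" for b
    proof (cases b)
      case (Top j k)
      then have "k < r" using that by (auto simp: Wbasis_def)
      then have k: "k = r - 1" if "\<not> Suc k < r" using that by auto
      have "?c (Top j k) = (q p)\<^sup>2 * ?c (Top j (k + 1))"
        using cT[of "k + 1" j] by (simp del: Wwt.simps)
      then have "?c (Top j (k + 1)) = inverse ((q p)\<^sup>2) * ?c (Top j k)"
        by (simp del: Wwt.simps)
      then show ?thesis using Top k cTF[of j j]
        by (auto simp: linext_scale linext_minus ac_simps simp del: Wwt.simps)
    next
      case (Soc j k)
      have "?c (Soc j k) = (q p)\<^sup>2 * ?c (Soc j (k + 1))"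
        using cS[of "k + 1" j] by (simp del: Wwt.simps)
      then have "?c (Soc j (k + 1)) = inverse ((q p)\<^sup>2) * ?c (Soc j k)"
        by (simp del: Wwt.simps)
      then show ?thesis using Soc by (auto simp: linext_scale linext_minus ac_simps simp del: Wwt.simps)
    qed
    show "linext ?gE (?gF b) - linext ?gF (?gE b) =
        ((?c b - inverse (?c b)) / (q p - inverse (q p))) *\<^sub>C bvec b" if "b \<in> Wbasis p r n" for b
    proof (cases b)
      case (Top j k)
      then have k: "k < r" using that by (auto simp: Wbasis_def)
      have "linext ?gE (?gF b) = (a * (qint p (int k + 1) * qint p (int r - 1 - int k))) *\<^sub>C bvec b"
      proof (cases "k + 1 < r")
        case False
        then have "int r - 1 - int k = 0" using k by simp
        then show ?thesis using False by (simp add: Top)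
      qed (simp add: Top algebra_simps)
      moreover have "linext ?gF (?gE b) = (a * (qint p (int k) * qint p (int r - int k))) *\<^sub>C bvec b"
        using k r by (cases k) (auto simp: Top linext_scale algebra_simps)
      moreover have "(?c b - inverse (?c b)) / (q p - inverse (q p)) = a * qint p (int r - 1 - 2 * int k)"
        using sign_wt[OF assms(2)] by (simp add: Top)
      ultimately show ?thesis
        using qint_diff[OF assms(1), of "int k" "int r - 1 - int k"]
        by (simp add: cvec.scale_left_diff_distrib[symmetric] right_diff_distrib[symmetric])
    next
      case (Soc j k)
      then have k: "k < p - r" using that by (auto simp: Wbasis_def)
      have "linext ?gE (?gF b) = (- a * (qint p (int k + 1) * qint p (int p - int r - 1 - int k))) *\<^sub>C bvec b"
      proof (cases "k + 1 < p - r")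
        case False
        then have "int p - int r - 1 - int k = 0" using k by simp
        then show ?thesis using False by (simp add: Soc)
      qed (simp add: Soc algebra_simps)
      moreover have "linext ?gF (?gE b) = (- a * (qint p (int k) * qint p (int p - int r - int k))) *\<^sub>C bvec b"
        using k by (cases k) (auto simp: Soc linext_scale linext_minus algebra_simps)
      moreover have "(?c b - inverse (?c b)) / (q p - inverse (q p)) =
          - a * qint p (int p - int r - 1 - 2 * int k)"
        using sign_wt[OF na, of p "int p - int r - 1 - 2 * int k"] by (simp only: Soc Wwt.simps of_nat_mult of_nat_numeral)
      moreover have "qint p (int k + 1) * qint p (int p - int r - 1 - int k) -
          qint p (int k) * qint p (int p - int r - int k) = qint p (int p - int r - 1 - 2 * int k)"
        using qint_diff[OF assms(1), of "int k" "int p - int r - 1 - int k"]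
        by (simp add: algebra_simps)
      ultimately show ?thesis
        by (simp add: cvec.scale_left_diff_distrib[symmetric] right_diff_distrib[symmetric]
            del: mult_minus_left cvec.scale_minus_left)
    qed
    show "(linext ?gE ^^ p) (bvec b) = 0" if "b \<in> Wbasis p r n" for b
    proof (cases b)
      case (Top j k)
      then show ?thesis using that r
        by (auto simp: Wbasis_def intro!: funpow_linext_mono[OF EpT])
    next
      case (Soc j k)
      then show ?thesis using that r
        by (auto simp: Wbasis_def intro!: funpow_linext_mono[OF EpS])
    qed
    show "(linext ?gF ^^ p) (bvec b) = 0" if "b \<in> Wbasis p r n" for b
    proof (cases b)
      case (Top j k)
      then show ?thesis using that p FpT[of k "p - 1" j]
        by (auto simp: Wbasis_def simp del: funpow.simps)
    next
      case (Soc j k)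
      then show ?thesis using p FpS[of k "p - 1" j] by (simp del: funpow.simps)
    qed
  qed (use p in auto)
qed

section \<open>The product of the quantum plane on its generators\<close>

lemma gen_qint_nonzero:
  assumes "n > 0" shows "gen_qint n \<noteq> 0"
proof -
  have nz: "fls_X ^ n - fls_X_inv ^ n \<noteq> (0 :: complex fls)" if "n > 0" for n
  proof
    assume "fls_X ^ n - fls_X_inv ^ n = (0 :: complex fls)"
    then have "fls_nth (fls_X ^ n - fls_X_inv ^ n :: complex fls) (int n) = 0" by simp
    then show False using that by (simp add: fls_X_power_conv_shift_1 fls_X_inv_power_conv_shift_1)
  qed
  have "fls_X ^ n - fls_X_inv ^ n \<noteq> (0 :: complex fls)" "fls_X - fls_X_inv \<noteq> (0 :: complex fls)"
    using nz[OF assms] nz[of 1] by simp_all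
  then show ?thesis by (simp add: gen_qint_def)
qed

lemma qbinom_0 [simp]: "qbinom p n 0 = 1"
proof -
  have "gen_qfact n \<noteq> 0" by (auto simp: gen_qfact_def gen_qint_nonzero)
  then have "gen_qbinom n 0 = 1" by (simp add: gen_qbinom_def) (simp add: gen_qfact_def)
  moreover have "{k. fls_nth (1 :: complex fls) k \<noteq> 0} = {0}" by auto
  ultimately show ?thesis by (simp add: qbinom_def laurent_eval_def)
qed

lemma qbinom_self [simp]: "qbinom p n n = 1"
proof -
  have "gen_qbinom n n = gen_qbinom n 0" by (simp add: gen_qbinom_def mult.commute)
  then show ?thesis using qbinom_0[of p n] by (simp add: qbinom_def)
qed

theorem amult_relations:
  "amult (qplane p) (mon m 0) (mon n 0) = qbinom p (m + n) m *\<^sub>C mon (m + n) 0"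
  "amult (qplane p) (mon 0 m) (mon 0 n) = qbinom p (m + n) m *\<^sub>C mon 0 (m + n)"
  "amult (qplane p) (mon 0 n) (mon m 0) = q p ^ (n * m) *\<^sub>C amult (qplane p) (mon m 0) (mon 0 n)"
  "amult (qplane p) (mon m 0) (mon 0 n) = mon m n"
  by (simp_all add: qplane_def)

end

theory Submission
  imports Defs "HOL-Library.Disjoint_Sets"
begin

text \<open>In degree \<open>N\<close>, order the monomials \<open>x\<^sup>(\<^sup>N\<^sup>-\<^sup>t\<^sup>)y\<^sup>(\<^sup>t\<^sup>)\<close> by \<open>t\<close>. Then \<open>F\<close> raises \<open>t\<close> with
  coefficient \<open>[t + 1]\<close>, which vanishes only if \<open>p\<close> divides \<open>t + 1\<close>, and \<open>E\<close> lowers \<open>t\<close> with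
  coefficient \<open>[N + 1 - t]\<close>, which vanishes only if \<open>p\<close> divides \<open>N + 1 - t\<close>. Writing
  \<open>N + 1 = (n - 1)p + r\<close> with \<open>1 \<le> r \<le> p\<close>, the chain \<open>0 \<le> t \<le> N\<close> is cut into blocks of lengths
  \<open>r, p - r, r, \<dots>, r\<close>. For \<open>r < p\<close> neighbouring blocks are joined by a single nonzero arrow, out of
  the blocks of length \<open>r\<close>, and for \<open>r = p\<close> the \<open>n\<close> blocks are not joined at all. Rescaling the
  monomials along the chain turns the nonzero arrows into the normal form of the zigzag and
  irreducible modules.\<close>

section \<open>Coordinate subspaces\<close>

lemma keys_sum_subset:
  assumes "\<And>i. i \<in> I \<Longrightarrow> Poly_Mapping.keys (f i) \<subseteq> T"
  shows "Poly_Mapping.keys (\<Sum>i\<in>I. f i) \<subseteq> T"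
  using assms
  by (induction I rule: infinite_finite_induct)
    (auto dest!: subsetD[OF Poly_Mapping.keys_add])

text \<open>Turns membership in a coordinate subspace into a condition on supports, so that later
  questions about spans become questions about sets of basis elements.\<close>

lemma span_bvec_eq: "cvec.span (bvec ` T) = {v. Poly_Mapping.keys v \<subseteq> T}"
proof (intro equalityI subsetI CollectI)
  fix v b assume v: "v \<in> cvec.span (bvec ` T)" and b: "b \<in> Poly_Mapping.keys v"
  from v have "\<forall>b. b \<notin> T \<longrightarrow> Poly_Mapping.lookup v b = 0"
    by (induction rule: cvec.span_induct_alt) (auto simp: lookup_add lookup_bvec split: if_splits)
  then show "b \<in> T" using b by (auto simp: in_keys_iff)
next
  fix v :: "'a \<Rightarrow>\<^sub>0 complex" assume "v \<in> {v. Poly_Mapping.keys v \<subseteq> T}"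
  then have "linext bvec v \<in> cvec.span (bvec ` T)"
    unfolding linext_def by (intro cvec.span_sum cvec.span_scale cvec.span_base) auto
  then show "v \<in> cvec.span (bvec ` T)" by (simp add: linext_bvec_id)
qed

text \<open>The map is the projection onto the coordinates in \<open>T\<close>; it supplies the
  components of a vector in a direct sum.\<close>

lemma lookup_linext_restrict:
  "Poly_Mapping.lookup (linext (\<lambda>b. if b \<in> T then bvec b else 0) v) b =
     (if b \<in> T then Poly_Mapping.lookup v b else 0)"
proof -
  have "Poly_Mapping.lookup (linext (\<lambda>b. if b \<in> T then bvec b else 0) v) b =
      (\<Sum>c\<in>Poly_Mapping.keys v. if c = b then (if b \<in> T then Poly_Mapping.lookup v b else 0) else 0)"
    unfolding linext_def lookup_sum by (intro sum.cong) (auto simp: lookup_bvec)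
  then show ?thesis by (simp add: in_keys_iff)
qed

text \<open>By disjointness, the coordinate at \<open>b \<in> T i\<close> of a sum comes from the
  component \<open>f i\<close> alone. This gives uniqueness at once, and existence by cutting a
  vector into its restrictions.\<close>

lemma direct_sum_span_bvec:
  assumes I: "finite I" and disj: "disjoint_family_on T I"
    and V: "V = cvec.span (bvec ` (\<Union>i\<in>I. T i))"
    and N: "\<And>i. i \<in> I \<Longrightarrow> N i = cvec.span (bvec ` T i)"
  shows "direct_sum V I N"
proof -
  have lookup: "Poly_Mapping.lookup (\<Sum>i\<in>I. f i) b = Poly_Mapping.lookup (f i) b"
    if "f \<in> Pi\<^sub>E I N" "i \<in> I" "b \<in> T i" for f i b
  proof -
    have "Poly_Mapping.lookup (f j) b = 0" if "j \<in> I - {i}" for j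
    proof -
      have "f j \<in> N j" using \<open>f \<in> Pi\<^sub>E I N\<close> that by auto
      moreover have "b \<notin> T j"
        using disj that \<open>i \<in> I\<close> \<open>b \<in> T i\<close> by (auto simp: disjoint_family_on_def)
      ultimately show ?thesis using that N by (auto simp: span_bvec_eq in_keys_iff)
    qed
    then show ?thesis using I \<open>i \<in> I\<close>
      unfolding lookup_sum by (simp add: sum.remove[of I i])
  qed
  have "inj_on (\<lambda>f. \<Sum>i\<in>I. f i) (Pi\<^sub>E I N)"
  proof (rule inj_onI)
    fix f g assume f: "f \<in> Pi\<^sub>E I N" and g: "g \<in> Pi\<^sub>E I N" and eq: "(\<Sum>i\<in>I. f i) = (\<Sum>i\<in>I. g i)"
    show "f = g"
    proof (rule PiE_ext[OF f g])
      fix i assume i: "i \<in> I"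
      have "f i \<in> N i" "g i \<in> N i" using f g i by auto
      then have 0: "Poly_Mapping.lookup (f i) b = 0 \<and> Poly_Mapping.lookup (g i) b = 0"
        if "b \<notin> T i" for b
        using that i N by (auto simp: span_bvec_eq in_keys_iff)
      show "f i = g i"
        by (rule poly_mapping_eqI) (metis 0 lookup[OF f i] lookup[OF g i] eq)
    qed
  qed
  moreover have "(\<Sum>i\<in>I. f i) \<in> V" if f: "f \<in> Pi\<^sub>E I N" for f
  proof -
    have "Poly_Mapping.keys (f i) \<subseteq> (\<Union>i\<in>I. T i)" if "i \<in> I" for i
      using PiE_mem[OF f that] N[OF that] that by (auto simp: span_bvec_eq)
    then show ?thesis unfolding V span_bvec_eq by (intro CollectI keys_sum_subset)
  qed
  moreover have "\<exists>f\<in>Pi\<^sub>E I N. v = (\<Sum>i\<in>I. f i)" if "v \<in> V" for v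
  proof -
    \<comment> \<open>The restrictions of \<open>v\<close> to the \<open>T i\<close>; the bounded
      lambda makes the family undefined outside \<open>I\<close>, as \<open>Pi\<^sub>E\<close>
      demands.\<close>
    define f where "f = (\<lambda>i\<in>I. linext (\<lambda>b. if b \<in> T i then bvec b else 0) v)"
    have f: "f \<in> Pi\<^sub>E I N"
      by (auto simp: f_def N span_bvec_eq in_keys_iff lookup_linext_restrict split: if_splits)
    have "v = (\<Sum>i\<in>I. f i)"
    proof (rule poly_mapping_eqI)
      fix b
      show "Poly_Mapping.lookup v b = Poly_Mapping.lookup (\<Sum>i\<in>I. f i) b"
      proof (cases "b \<in> (\<Union>i\<in>I. T i)")
        case True
        then obtain i where "i \<in> I" "b \<in> T i" by auto
        then show ?thesis using lookup[OF f, of i b] by (simp add: f_def lookup_linext_restrict)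
      next
        case False
        then have "Poly_Mapping.lookup v b = 0"
          using that unfolding V span_bvec_eq by (auto simp: in_keys_iff)
        moreover have "Poly_Mapping.lookup (f i) b = 0" if "i \<in> I" for i
          using that False by (simp add: f_def lookup_linext_restrict)
        ultimately show ?thesis by (simp add: lookup_sum)
      qed
    qed
    with f show ?thesis by blast
  qed
  ultimately show ?thesis
    unfolding direct_sum_def bij_betw_def by (auto simp: image_iff)
qed

section \<open>Submodules and isomorphisms from monomial maps of bases\<close>

text \<open>The defining relations hold pointwise and are inherited from \<open>M\<close>, so
  stability under the four operators is all that is left to check.\<close>

lemma U_submoduleI:
  assumes M: "U_module p M" and S: "cvec.subspace S" "S \<subseteq> car M"
    and stable: "\<And>v. v \<in> S \<Longrightarrow> actE M v \<in> S" "\<And>v. v \<in> S \<Longrightarrow> actF M v \<in> S"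
      "\<And>v. v \<in> S \<Longrightarrow> actK M v \<in> S" "\<And>v. v \<in> S \<Longrightarrow> actKi M v \<in> S"
  shows "U_submodule p M S"
proof -
  have "linear_on_set S T" if "linear_on_set (car M) T" for T :: "('a \<Rightarrow>\<^sub>0 complex) \<Rightarrow> 'a \<Rightarrow>\<^sub>0 complex"
    using that S(2) by (auto simp: linear_on_set_def subset_iff)
  then have lin: "\<forall>T\<in>{actE M, actF M, actK M, actKi M}. T ` S \<subseteq> S \<and> linear_on_set S T"
    using M stable unfolding U_module_def by blast
  have upd: "car (M\<lparr>car := S\<rparr>) = S" "actE (M\<lparr>car := S\<rparr>) = actE M" "actF (M\<lparr>car := S\<rparr>) = actF M"
    "actK (M\<lparr>car := S\<rparr>) = actK M" "actKi (M\<lparr>car := S\<rparr>) = actKi M" by simp_all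
  note rels = M[unfolded U_module_def, THEN conjunct2, THEN conjunct2]
  show ?thesis
    unfolding U_submodule_def U_module_def upd
    by (intro conjI S lin) (use S(2) rels in blast)
qed

lemma linext_compose: "linext g (linext f v) = linext (\<lambda>b. linext g (f b)) v"
proof -
  have "linext g (\<Sum>b\<in>B. c b *\<^sub>C f b) = (\<Sum>b\<in>B. c b *\<^sub>C linext g (f b))" if "finite B" for B c
    using that by (induction B) (simp_all add: linext_add linext_scale)
  then show ?thesis by (simp add: linext_def[of f] linext_def[of "\<lambda>b. linext g (f b)"])
qed

lemma linext_cong:
  assumes "v \<in> cvec.span (bvec ` B)" "\<And>b. b \<in> B \<Longrightarrow> f b = g b"
  shows "linext f v = linext g v"
  using assms unfolding span_bvec_eq linext_def by (auto intro!: sum.cong)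

text \<open>\<open>h\<close> carries the basis of \<open>N\<close> to nonzero multiples of distinct
  monomials, so it is a linear bijection onto their span. Commutation with \<open>E\<close>,
  \<open>F\<close>, \<open>K\<close> needs checking on the basis only, and stability of the span is
  transported from \<open>N\<close>.\<close>

lemma sub_iso_monomialI:
  fixes N :: "'c umod"
  assumes p: "p \<ge> 2" and N: "U_module p N" and car: "car N = cvec.span (bvec ` B)"
    and acts: "actE N = linext gE" "actF N = linext gF" "actK N = linext gK" "actKi N = linext gKi"
    and \<phi>: "bij_betw \<phi> B T" and \<gamma>: "\<And>b. b \<in> B \<Longrightarrow> \<gamma> b \<noteq> 0"
    and h_def: "h = linext (\<lambda>b. \<gamma> b *\<^sub>C bvec (\<phi> b))"
    and E: "\<And>b. b \<in> B \<Longrightarrow> actE (qplane p) (\<gamma> b *\<^sub>C bvec (\<phi> b)) = h (gE b)"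
    and F: "\<And>b. b \<in> B \<Longrightarrow> actF (qplane p) (\<gamma> b *\<^sub>C bvec (\<phi> b)) = h (gF b)"
    and K: "\<And>b. b \<in> B \<Longrightarrow> actK (qplane p) (\<gamma> b *\<^sub>C bvec (\<phi> b)) = h (gK b)"
  shows "sub_iso p (cvec.span (bvec ` T)) N"
proof -
  let ?V = "cvec.span (bvec ` B)" and ?S = "cvec.span (bvec ` T)" and ?Q = "qplane p"
  define \<psi> where "\<psi> = inv_into B \<phi>"
  \<comment> \<open>The inverse of \<open>h\<close>: undo the relabelling \<open>\<phi>\<close> and
    divide by the scaling \<open>\<gamma>\<close>.\<close>
  define f where "f = linext (\<lambda>t. inverse (\<gamma> (\<psi> t)) *\<^sub>C bvec (\<psi> t))"
  have \<psi>: "\<psi> (\<phi> b) = b" if "b \<in> B" for b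
    using \<phi> that by (auto simp: \<psi>_def bij_betw_def)
  have \<psi>': "\<phi> (\<psi> t) = t" "\<psi> t \<in> B" if "t \<in> T" for t
    using \<phi> that by (auto simp: \<psi>_def bij_betw_def f_inv_into_f inv_into_into)
  have Q: "U_module p ?Q" by (rule U_module_qplane[OF p])
  have fh: "f (h v) = v" if "v \<in> ?V" for v
  proof -
    have "f (h v) = linext bvec v" unfolding f_def h_def linext_compose
      by (rule linext_cong[OF that]) (simp add: linext_scale \<psi> \<gamma>)
    then show ?thesis by (simp add: linext_bvec_id)
  qed
  have hf: "h (f w) = w" if "w \<in> ?S" for w
  proof -
    have "h (f w) = linext bvec w" unfolding f_def h_def linext_compose
      by (rule linext_cong[OF that]) (simp add: linext_scale \<psi>' \<gamma>)
    then show ?thesis by (simp add: linext_bvec_id)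
  qed
  have h_in: "h v \<in> ?S" if "v \<in> ?V" for v
    unfolding h_def linext_def
    by (intro cvec.span_sum cvec.span_scale cvec.span_base)
      (use that \<phi> in \<open>auto simp: span_bvec_eq bij_betw_def\<close>)
  have f_in: "f w \<in> ?V" if "w \<in> ?S" for w
    unfolding f_def linext_def
    by (intro cvec.span_sum cvec.span_scale cvec.span_base)
      (use that \<psi>' in \<open>auto simp: span_bvec_eq\<close>)
  obtain qE qF qK where Qacts: "actE ?Q = linext qE" "actF ?Q = linext qF" "actK ?Q = linext qK"
    by (simp add: qplane_def)
  have hE: "actE ?Q (h v) = h (actE N v)" if "v \<in> ?V" for v
    using E unfolding h_def acts Qacts linext_compose by (intro linext_cong[OF that])
  have hF: "actF ?Q (h v) = h (actF N v)" if "v \<in> ?V" for v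
    using F unfolding h_def acts Qacts linext_compose by (intro linext_cong[OF that])
  have hK: "actK ?Q (h v) = h (actK N v)" if "v \<in> ?V" for v
    using K unfolding h_def acts Qacts linext_compose by (intro linext_cong[OF that])
  have N_in: "actE N v \<in> ?V" "actF N v \<in> ?V" "actK N v \<in> ?V" "actKi N v \<in> ?V" if "v \<in> ?V" for v
    using N that unfolding U_module_def car by auto
  have hKi: "actKi ?Q (h v) = h (actKi N v)" if "v \<in> ?V" for v
  proof -
    \<comment> \<open>Commutation with the inverse of \<open>K\<close> is deduced from
      \<open>hK\<close> at \<open>actKi N v\<close>, by cancelling \<open>K\<close> on the
      plane.\<close>
    have "h v = actK ?Q (h (actKi N v))"
      using N that hK[OF N_in(4)[OF that]] by (auto simp: U_module_def car)
    then show ?thesis using Q by (simp add: U_module_def qplane_def)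
  qed
  \<comment> \<open>One transport argument for all four operators: write \<open>w\<close> as
    \<open>h (f w)\<close> and move the operator through \<open>h\<close>.\<close>
  have tr: "a w \<in> ?S \<and> f (a w) = a' (f w)"
    if "w \<in> ?S" "\<And>v. v \<in> ?V \<Longrightarrow> a (h v) = h (a' v)" "\<And>v. v \<in> ?V \<Longrightarrow> a' v \<in> ?V" for a a' w
    by (metis that hf fh f_in h_in)
  have E': "actE ?Q w \<in> ?S \<and> f (actE ?Q w) = actE N (f w)" if "w \<in> ?S" for w
    by (rule tr[where a = "actE ?Q" and a' = "actE N", OF that hE N_in(1)])
  have F': "actF ?Q w \<in> ?S \<and> f (actF ?Q w) = actF N (f w)" if "w \<in> ?S" for w
    by (rule tr[where a = "actF ?Q" and a' = "actF N", OF that hF N_in(2)])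
  have K': "actK ?Q w \<in> ?S \<and> f (actK ?Q w) = actK N (f w)" if "w \<in> ?S" for w
    by (rule tr[where a = "actK ?Q" and a' = "actK N", OF that hK N_in(3)])
  have Ki': "actKi ?Q w \<in> ?S \<and> f (actKi ?Q w) = actKi N (f w)" if "w \<in> ?S" for w
    by (rule tr[where a = "actKi ?Q" and a' = "actKi N", OF that hKi N_in(4)])
  have "U_submodule p ?Q ?S"
    by (rule U_submoduleI[OF Q]) (use E' F' K' Ki' in \<open>auto simp: cvec.subspace_span qplane_def\<close>)
  moreover have "bij_betw f ?S ?V"
    by (rule bij_betw_byWitness[where f' = h]) (use fh hf h_in f_in in auto)
  then have "U_iso (?Q\<lparr>car := ?S\<rparr>) N"
    unfolding U_iso_def using E' F' K' Ki' car
    by (intro exI[of _ f]) (auto simp: f_def linear_on_set_linext)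
  ultimately show ?thesis by blast
qed

section \<open>Quantum integers at the root of unity\<close>

lemma qint_minus: "qint p (- x) = - qint p x"
  by (simp add: qint_def minus_divide_left)

lemma q_powi_mult_p:
  assumes "p > 0"
  shows "q p powi (int c * int p + x) = (-1) ^ c * q p powi x"
proof -
  have "q p powi (int c * int p) = (-1) ^ c"
    using q_pow_p[OF assms] by (metis mult.commute of_nat_mult power_int_of_nat power_mult)
  then show ?thesis by (simp add: power_int_add)
qed

text \<open>Since \<open>q p ^ p = -1\<close>, both powers in the numerator pick up the same sign
  \<open>(-1) ^ c\<close>.\<close>

lemma qint_add_mult_p:
  assumes "p > 0"
  shows "qint p (int c * int p + x) = (-1) ^ c * qint p x"
proof -
  have "q p powi (int c * int p) = (-1) ^ c"
    using q_powi_mult_p[OF assms, of c 0] by simp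
  moreover have "q p powi (- (int c * int p)) = (-1) ^ c"
    using calculation by (simp add: power_int_minus flip: power_inverse)
  ultimately show ?thesis
    by (simp add: qint_def power_int_add power_int_diff divide_inverse algebra_simps
        flip: power_int_minus power_inverse)
qed

lemma qint_p_minus:
  assumes "p > 0" shows "qint p (int p - x) = qint p x"
  using qint_add_mult_p[OF assms, of 1 "- x"] by (simp add: qint_minus)

text \<open>Shifting by multiples of \<open>p\<close> changes only the sign, so \<open>k\<close> may
  be replaced by \<open>k mod p\<close>; for a nonzero remainder \<open>m\<close> the value is
  governed by \<open>sin (m * pi / p)\<close>, which is positive.\<close>

lemma qint_eq_0_iff:
  assumes "p \<ge> 2" shows "qint p (int k) = 0 \<longleftrightarrow> p dvd k"
proof -
  have p: "p > 0" using assms by simp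
  have "qint p (int (k mod p)) \<noteq> 0" if "k mod p \<noteq> 0"
  proof
    let ?m = "k mod p"
    assume "qint p (int ?m) = 0"
    \<comment> \<open>A vanishing numerator makes this power its own inverse; comparing imaginary
      parts then forces the sine to be zero.\<close>
    then have "q p ^ ?m = inverse (q p ^ ?m)"
      using q_diff_nonzero[OF assms] by (simp add: qint_def power_int_minus)
    moreover have "q p = cis (pi / p)" by (simp add: q_def cis_conv_exp)
    then have "q p ^ ?m = cis (?m * (pi / p))" by (simp only: Complex.DeMoivre)
    ultimately have "Im (cis (?m * (pi / p))) = Im (inverse (cis (?m * (pi / p))))" by simp
    then have "sin (?m * (pi / p)) = 0" by (simp add: cis_inverse)
    moreover have "sin (?m * (pi / p)) > 0"
    proof (rule sin_gt_zero)
      show "0 < ?m * (pi / p)" using that p by simp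
      have "real ?m < real p" using p by simp
      then show "?m * (pi / p) < pi" using p by (simp add: field_simps)
    qed
    ultimately show False by simp
  qed
  moreover have "int k = int (k div p) * int p + int (k mod p)"
    by (metis div_mult_mod_eq of_nat_add of_nat_mult)
  then have "qint p (int k) = (-1) ^ (k div p) * qint p (int (k mod p))"
    by (metis qint_add_mult_p[OF p])
  ultimately show ?thesis by (auto simp: dvd_eq_mod_eq_0)
qed

section \<open>The rescaled monomials of a fixed degree\<close>

text \<open>The factor at \<open>s\<close> makes the arrow between the positions \<open>s - 1\<close> and \<open>s\<close> into the coefficient 1:
  for \<open>p\<close> dividing \<open>s\<close> the arrow \<open>F\<close> vanishes and \<open>E\<close> is normalised instead; if \<open>p\<close> also divides
  \<open>N + 1\<close>, both vanish.\<close>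

definition chain_factor :: "nat \<Rightarrow> nat \<Rightarrow> nat \<Rightarrow> complex"
  where "chain_factor p N s =
    (if \<not> p dvd s then qint p (int s)
     else if p dvd N + 1 then 1 else inverse (qint p (int N + 1 - int s)))"

definition chain_scale :: "nat \<Rightarrow> nat \<Rightarrow> nat \<Rightarrow> complex"
  where "chain_scale p N t = (\<Prod>s=1..t. chain_factor p N s)"

definition chain_vec :: "nat \<Rightarrow> nat \<Rightarrow> nat \<Rightarrow> (nat \<times> nat) \<Rightarrow>\<^sub>0 complex"
  where "chain_vec p N t = chain_scale p N t *\<^sub>C mon (N - t) t"

lemma qint_top_nonzero:
  assumes "p \<ge> 2" "s \<le> N" "p dvd s" "\<not> p dvd N + 1"
  shows "qint p (int N + 1 - int s) \<noteq> 0"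
proof -
  have "int N + 1 - int s = int (N + 1 - s)" using assms(2) by simp
  moreover have "\<not> p dvd N + 1 - s" using assms by (metis dvd_diffD le_SucI Suc_eq_plus1)
  ultimately show ?thesis using qint_eq_0_iff[OF assms(1)] by metis
qed

lemma chain_scale_nonzero:
  assumes "p \<ge> 2" "t \<le> N" shows "chain_scale p N t \<noteq> 0"
proof -
  have "chain_factor p N s \<noteq> 0" if "s \<le> t" for s
    using that assms qint_top_nonzero[of p s N] by (auto simp: chain_factor_def qint_eq_0_iff)
  then show ?thesis by (auto simp: chain_scale_def)
qed

lemma chain_scale_Suc: "chain_scale p N (Suc t) = chain_factor p N (Suc t) * chain_scale p N t"
  by (simp add: chain_scale_def)

lemma qplane_mon:
  "actE (qplane p) (mon m n) = (if n = 0 then 0 else qint p (int m + 1) *\<^sub>C mon (m + 1) (n - 1))"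
  "actF (qplane p) (mon m n) = (if m = 0 then 0 else qint p (int n + 1) *\<^sub>C mon (m - 1) (n + 1))"
  "actK (qplane p) (mon m n) = q p powi (int m - int n) *\<^sub>C mon m n"
  by (simp_all add: qplane_def algebra_simps)

lemma qplane_scale:
  "actE (qplane p) (c *\<^sub>C v) = c *\<^sub>C actE (qplane p) v"
  "actF (qplane p) (c *\<^sub>C v) = c *\<^sub>C actF (qplane p) v"
  "actK (qplane p) (c *\<^sub>C v) = c *\<^sub>C actK (qplane p) v"
  by (simp_all add: qplane_def linext_scale)

lemma actE_chain_vec_0: "actE (qplane p) (chain_vec p N 0) = 0"
  by (simp add: chain_vec_def qplane_scale qplane_mon)

text \<open>The raw coefficient \<open>[N - t]\<close> is multiplied by the chain factor at
  \<open>t + 1\<close>. Inside a block that factor is \<open>[t + 1]\<close>; at a block boundary it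
  cancels \<open>[N - t]\<close>, unless \<open>p\<close> divides \<open>N + 1\<close>, when
  \<open>p\<close> divides \<open>N - t\<close> too and the arrow is zero.\<close>

lemma actE_chain_vec_Suc:
  assumes "p \<ge> 2" "Suc t \<le> N"
  shows "actE (qplane p) (chain_vec p N (Suc t)) =
    (if \<not> p dvd Suc t then qint p (int t + 1) * qint p (int N - int t)
     else if p dvd N + 1 then 0 else 1) *\<^sub>C chain_vec p N t"
proof -
  have 1: "actE (qplane p) (chain_vec p N (Suc t)) =
      (chain_scale p N t * (chain_factor p N (Suc t) * qint p (int N - int t))) *\<^sub>C mon (N - t) t"
    using assms(2)
    by (simp add: chain_vec_def qplane_scale qplane_mon chain_scale_Suc of_nat_diff Suc_diff_Suc
        algebra_simps)
  have "qint p (int N - int t) = 0" if "p dvd N + 1" "p dvd Suc t"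
  proof -
    have "p dvd N + 1 - Suc t" using that by (rule dvd_diff_nat)
    then have "qint p (int (N - t)) = 0" using qint_eq_0_iff[OF assms(1)] by simp
    then show ?thesis using assms(2) by (simp add: of_nat_diff)
  qed
  moreover have "qint p (int N - int t) \<noteq> 0" if "\<not> p dvd N + 1" "p dvd Suc t"
    using qint_top_nonzero[OF assms that(2,1)] by simp
  ultimately show ?thesis
    unfolding 1 by (auto simp: chain_vec_def chain_factor_def ac_simps)
qed

text \<open>The coefficient \<open>[t + 1]\<close> of \<open>F\<close> is absorbed into the next
  scale, except at a block boundary, where it vanishes.\<close>

lemma actF_chain_vec:
  assumes "p \<ge> 2" "t \<le> N"
  shows "actF (qplane p) (chain_vec p N t) =
    (if t = N \<or> p dvd Suc t then 0 else chain_vec p N (Suc t))"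
proof (cases "t = N")
  case False
  have "qint p (int t + 1) = 0 \<longleftrightarrow> p dvd Suc t"
    using qint_eq_0_iff[OF assms(1), of "Suc t"] by (simp add: add.commute)
  then show ?thesis using False assms
    by (auto simp: chain_vec_def qplane_scale qplane_mon chain_scale_Suc chain_factor_def ac_simps)
qed (simp add: chain_vec_def qplane_scale qplane_mon)

lemma actK_chain_vec:
  assumes "t \<le> N"
  shows "actK (qplane p) (chain_vec p N t) = q p powi (int N - 2 * int t) *\<^sub>C chain_vec p N t"
  using assms by (simp add: chain_vec_def qplane_scale qplane_mon of_nat_diff ac_simps)

text \<open>The monomial criterion along the chain of degree \<open>D\<close>: the scaling is that
  of \<open>chain_vec\<close>, and since \<open>K\<close> is diagonal on both sides its condition
  shrinks to an equality of weights.\<close>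

lemma sub_iso_chainI:
  fixes N :: "'c umod"
  assumes p: "p \<ge> 2" and N: "U_module p N" and car: "car N = cvec.span (bvec ` B)"
    and acts: "actE N = linext gE" "actF N = linext gF"
      "actK N = linext (\<lambda>b. w b *\<^sub>C bvec b)" "actKi N = linext gKi"
    and \<tau>: "inj_on \<tau> B" "\<And>b. b \<in> B \<Longrightarrow> \<tau> b \<le> D"
    and T: "T = (\<lambda>b. (D - \<tau> b, \<tau> b)) ` B"
    and h_def: "h = linext (\<lambda>b. chain_vec p D (\<tau> b))"
    and E: "\<And>b. b \<in> B \<Longrightarrow> actE (qplane p) (chain_vec p D (\<tau> b)) = h (gE b)"
    and F: "\<And>b. b \<in> B \<Longrightarrow> actF (qplane p) (chain_vec p D (\<tau> b)) = h (gF b)"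
    and K: "\<And>b. b \<in> B \<Longrightarrow> q p powi (int D - 2 * int (\<tau> b)) = w b"
  shows "sub_iso p (cvec.span (bvec ` T)) N"
proof (rule sub_iso_monomialI[OF p N car acts])
  show "bij_betw (\<lambda>b. (D - \<tau> b, \<tau> b)) B T"
    using \<tau>(1) T by (auto simp: bij_betw_def inj_on_def)
  show "chain_scale p D (\<tau> b) \<noteq> 0" if "b \<in> B" for b
    using chain_scale_nonzero[OF p \<tau>(2)[OF that]] .
  show "h = linext (\<lambda>b. chain_scale p D (\<tau> b) *\<^sub>C bvec (D - \<tau> b, \<tau> b))"
    by (simp add: h_def chain_vec_def)
  show "actE (qplane p) (chain_scale p D (\<tau> b) *\<^sub>C mon (D - \<tau> b) (\<tau> b)) = h (gE b)" if "b \<in> B" for b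
    using E[OF that] by (simp add: chain_vec_def)
  show "actF (qplane p) (chain_scale p D (\<tau> b) *\<^sub>C mon (D - \<tau> b) (\<tau> b)) = h (gF b)" if "b \<in> B" for b
    using F[OF that] by (simp add: chain_vec_def)
  show "actK (qplane p) (chain_scale p D (\<tau> b) *\<^sub>C mon (D - \<tau> b) (\<tau> b)) = h (w b *\<^sub>C bvec b)"
    if "b \<in> B" for b
    using actK_chain_vec[OF \<tau>(2)[OF that], of p] K[OF that]
    by (simp add: h_def linext_scale flip: chain_vec_def)
qed

section \<open>The summands\<close>

text \<open>The parameter \<open>c\<close> is \<open>n - 1\<close>, and blocks are counted from \<open>i = 0\<close>.\<close>

lemma chain_weight:
  assumes "p > 0" "D + 1 = c * p + r"
  shows "q p powi (int D - 2 * int (i * p + k)) = (-1) ^ c * q p powi (int r - 1 - 2 * int k)"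
proof -
  have "int D + 1 = int c * int p + int r" using assms(2) by (metis of_nat_1 of_nat_add of_nat_mult)
  then have "int c * int p + (int r - 1 - 2 * int k) = int (2 * i) * int p + (int D - 2 * int (i * p + k))"
    by (simp add: algebra_simps)
  then have "(-1) ^ c * q p powi (int r - 1 - 2 * int k) =
      (-1) ^ (2 * i) * q p powi (int D - 2 * int (i * p + k))"
    by (metis q_powi_mult_p[OF assms(1)])
  then show ?thesis by simp
qed

text \<open>The two factors contribute the signs \<open>(-1) ^ i\<close> and
  \<open>(-1) ^ (c - i)\<close>, whose product does not depend on the block.\<close>

lemma chain_coeff:
  assumes "p > 0" "D + 1 = c * p + r" "i \<le> c"
  shows "qint p (int (i * p + k) + 1) * qint p (int D - int (i * p + k)) =
    (-1) ^ c * (qint p (int k + 1) * qint p (int r - (int k + 1)))"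
proof -
  have "int D + 1 = int c * int p + int r" using assms(2) by (metis of_nat_1 of_nat_add of_nat_mult)
  then have "int D - int (i * p + k) = int (c - i) * int p + (int r - (int k + 1))"
    using assms(3) by (simp add: of_nat_diff algebra_simps)
  then have "qint p (int D - int (i * p + k)) = (-1) ^ (c - i) * qint p (int r - (int k + 1))"
    by (metis qint_add_mult_p[OF assms(1)])
  moreover have "qint p (int (i * p + k) + 1) = (-1) ^ i * qint p (int k + 1)"
    using qint_add_mult_p[OF assms(1), of i "int k + 1"] by (simp add: add.assoc)
  moreover have "(-1) ^ c = ((-1) ^ i * (-1) ^ (c - i) :: complex)"
    using assms(3) by (simp flip: power_add)
  ultimately show ?thesis by simp
qed

text \<open>Covers the two situations in which a block stands alone: the chain is a single block
  (\<open>c = 0\<close>), or all blocks have length \<open>p\<close> and no arrow joins them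
  (\<open>r = p\<close>).\<close>

lemma sub_iso_Xmod:
  assumes p: "p \<ge> 2" and r: "1 \<le> r" "r \<le> p" and D: "D + 1 = c * p + r" and i: "i \<le> c"
    and cr: "c = 0 \<or> r = p"
  shows "sub_iso p (cvec.span (bvec ` (\<lambda>k. (D - (i * p + k), i * p + k)) ` {..<r})) (Xmod p ((-1) ^ c) r)"
proof -
  let ?a = "(-1) ^ c :: complex"
  have p0: "p > 0" using p by simp
  have a: "?a \<in> {1, -1}" by (cases "even c") auto
  have le: "i * p + k \<le> D" if "k < r" for k
    using that D mult_le_mono1[OF i, of p] by linarith
  have dvd_iff: "p dvd i * p + k \<longleftrightarrow> p dvd k" for k by simp
  have nd: "\<not> p dvd Suc k" if "Suc k < r" for k using that r by (auto dest: dvd_imp_le)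
  show ?thesis
  proof (rule sub_iso_chainI[OF p U_module_Xmod[OF p a r], where \<tau> = "\<lambda>k. i * p + k" and D = D])
    show "actK (Xmod p ?a r) = linext (\<lambda>k. (?a * q p powi (int r - 1 - 2 * int k)) *\<^sub>C bvec k)"
      by (simp add: Xmod_def)
    show "actE (qplane p) (chain_vec p D (i * p + k)) =
      linext (\<lambda>k. chain_vec p D (i * p + k))
       (if k = 0 then 0 else (?a * qint p (int k) * qint p (int r - int k)) *\<^sub>C bvec (k - 1))"
      if "k \<in> {..<r}" for k
    proof (cases k)
      case 0
      show ?thesis
      proof (cases "i * p")
        case (Suc t)
        \<comment> \<open>A block away from the start of the chain forces \<open>c > 0\<close>,
          hence \<open>r = p\<close>, and then \<open>E\<close> has no arrow into the preceding
          block.\<close>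
        then have "i > 0" by (cases i) auto
        then have "p dvd D + 1" using cr D i by auto
        moreover have "p dvd Suc t" by (simp flip: Suc)
        ultimately show ?thesis using Suc 0 le[of 0] r by (simp add: actE_chain_vec_Suc[OF p])
      qed (use 0 p0 in \<open>auto simp: actE_chain_vec_0\<close>)
    next
      case (Suc l)
      have "\<not> p dvd Suc (i * p + l)"
        using that Suc r dvd_iff[of "Suc l"] by (auto dest: dvd_imp_le)
      then show ?thesis
        using Suc le[of k] that chain_coeff[OF p0 D i, of l]
        by (simp add: actE_chain_vec_Suc[OF p] linext_scale ac_simps)
    qed
    show "actF (qplane p) (chain_vec p D (i * p + k)) =
      linext (\<lambda>k. chain_vec p D (i * p + k)) (if k + 1 < r then bvec (k + 1) else 0)"
      if "k \<in> {..<r}" for k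
    proof (cases "k + 1 < r")
      case True
      then show ?thesis
        using le[of "Suc k"] nd[of k] dvd_iff[of "Suc k"] by (simp add: actF_chain_vec[OF p])
    next
      case False
      then have "Suc k = r" using that by simp
      moreover have "p dvd Suc (i * p + k)" if "Suc k = p"
        by (metis that add_Suc_right dvd_iff dvd_refl)
      \<comment> \<open>For \<open>c = 0\<close> the last vector ends the chain; for
        \<open>r = p\<close> the next position is a multiple of \<open>p\<close>. Either way
        \<open>F\<close> kills it.\<close>
      ultimately have "i * p + k = D \<or> p dvd Suc (i * p + k)" using cr i D by auto
      then show ?thesis using False le[of k] that by (auto simp: actF_chain_vec[OF p])
    qed
    show "q p powi (int D - 2 * int (i * p + k)) = ?a * q p powi (int r - 1 - 2 * int k)" for k
      by (rule chain_weight[OF p0 D])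
  qed (use le in \<open>auto simp: Xmod_def inj_on_def\<close>)
qed

text \<open>These positions are consecutive along the zigzag: both joining arrows, \<open>F\<close>
  from \<open>Top j (r - 1)\<close> to \<open>Soc j 0\<close> and \<open>E\<close> from
  \<open>Top j 0\<close> to \<open>Soc (j - 1) (p - r - 1)\<close>, connect neighbours.\<close>

fun chain_pos :: "nat \<Rightarrow> nat \<Rightarrow> wbasis \<Rightarrow> nat"
  where
    "chain_pos p r (Top j k) = (j - 1) * p + k"
  | "chain_pos p r (Soc j k) = (j - 1) * p + (r + k)"

text \<open>Division by \<open>p\<close> recovers \<open>j\<close> and the offset, and comparing the
  offset with \<open>r\<close> tells \<open>Top\<close> from \<open>Soc\<close>.\<close>

lemma chain_pos_inj:
  assumes "r \<le> p" shows "inj_on (chain_pos p r) (Wbasis p r n)"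
proof (rule inj_onI)
  have *: "j = j' \<and> k = k'" if "(j - 1) * p + k = (j' - 1) * p + k'" "k < p" "k' < p" "1 \<le> j" "1 \<le> j'"
    for j j' k k'
  proof -
    have "((j - 1) * p + k) div p = ((j' - 1) * p + k') div p"
      "((j - 1) * p + k) mod p = ((j' - 1) * p + k') mod p" using that(1) by simp_all
    then show ?thesis using that by simp
  qed
  fix b b' assume bb: "b \<in> Wbasis p r n" "b' \<in> Wbasis p r n" "chain_pos p r b = chain_pos p r b'"
  show "b = b'"
  proof (cases b)
    case (Top j k)
    then show ?thesis
      using bb assms *[of j k "case b' of Top j' k' \<Rightarrow> j' | Soc j' k' \<Rightarrow> j'"
          "case b' of Top j' k' \<Rightarrow> k' | Soc j' k' \<Rightarrow> r + k'"]
      by (auto simp: Wbasis_def less_diff_conv add.commute)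
  next
    case (Soc j k)
    then show ?thesis
      using bb assms *[of j "r + k" "case b' of Top j' k' \<Rightarrow> j' | Soc j' k' \<Rightarrow> j'"
          "case b' of Top j' k' \<Rightarrow> k' | Soc j' k' \<Rightarrow> r + k'"]
      by (auto simp: Wbasis_def less_diff_conv add.commute)
  qed
qed

lemma chain_pos_image:
  assumes "1 \<le> r" "r < p" "1 \<le> n" "D + 1 = (n - 1) * p + r"
  shows "chain_pos p r ` Wbasis p r n = {..D}"
proof (intro equalityI subsetI)
  fix t assume "t \<in> chain_pos p r ` Wbasis p r n"
  then obtain b where b: "b \<in> Wbasis p r n" "t = chain_pos p r b" by auto
  show "t \<in> {..D}"
  proof (cases b)
    case (Top j k)
    then have "j - 1 \<le> n - 1" "k < r" "t = (j - 1) * p + k" using b by (auto simp: Wbasis_def)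
    then show ?thesis using mult_le_mono1[OF \<open>j - 1 \<le> n - 1\<close>, of p] assms(4)
      unfolding atMost_iff by linarith
  next
    case (Soc j k)
    then have j: "1 \<le> j" "j \<le> n - 1" "k < p - r" using b by (auto simp: Wbasis_def)
    then have "(j - 1 + 1) * p \<le> (n - 1) * p" by (intro mult_le_mono1) simp
    moreover have "t = (j - 1) * p + (r + k)" using b Soc by simp
    ultimately show ?thesis using j assms(1,2,4) unfolding atMost_iff distrib_right by linarith
  qed
next
  fix t assume t: "t \<in> {..D}"
  define j k where "j = t div p + 1" and "k = t mod p"
  have t': "t = (j - 1) * p + k" by (simp add: j_def k_def)
  have "k < p" "1 \<le> j" using assms by (simp_all add: k_def j_def)
  have jn: "j \<le> n"
  proof (rule ccontr)
    assume "\<not> j \<le> n"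
    then have "n - 1 + 1 \<le> j - 1" using assms(3) by simp
    then have "(n - 1 + 1) * p \<le> (j - 1) * p" by (rule mult_le_mono1)
    then show False using t t' assms unfolding atMost_iff distrib_right by linarith
  qed
  show "t \<in> chain_pos p r ` Wbasis p r n"
  proof (cases "k < r")
    case True
    then have "Top j k \<in> Wbasis p r n" using jn \<open>1 \<le> j\<close> by (simp add: Wbasis_def)
    then show ?thesis using t' by (metis chain_pos.simps(1) imageI)
  next
    case False
    \<comment> \<open>The last block has only \<open>r\<close> positions, so an offset of at least
      \<open>r\<close> lies in an earlier one; this matches the \<open>n - 1\<close> socle
      copies.\<close>
    have "j \<noteq> n" using False t t' assms(4) by auto
    then have "Soc j (k - r) \<in> Wbasis p r n"
      using False jn \<open>k < p\<close> \<open>1 \<le> j\<close> by (auto simp: Wbasis_def)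
    moreover have "t = chain_pos p r (Soc j (k - r))" using False t' by simp
    ultimately show ?thesis by (metis imageI)
  qed
qed

section \<open>Whole degrees as zigzag modules\<close>

lemma A_deg_eq: "A_deg D = cvec.span (bvec ` {(m, n). m + n = D})"
  unfolding A_deg_def by (intro arg_cong[of _ _ cvec.span]) auto

lemma A_upto_eq: "A_upto D = cvec.span (bvec ` {(m, n). m + n \<le> D})"
  unfolding A_upto_def by (intro arg_cong[of _ _ cvec.span]) auto

lemma degree_monomials: "{(m, n). m + n = D} = (\<lambda>t. (D - t, t)) ` {..D :: nat}"
  by (auto simp: image_iff)

lemma sub_iso_Wmod:
  assumes p: "p \<ge> 2" and r: "1 \<le> r" "r \<le> p - 1" and n: "1 \<le> n" and D: "D + 1 = (n - 1) * p + r"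
  shows "sub_iso p (A_deg D) (Wmod p ((-1) ^ (n - 1)) r n)"
proof -
  let ?a = "(-1) ^ (n - 1) :: complex" and ?\<tau> = "chain_pos p r"
  let ?h = "linext (\<lambda>b. chain_vec p D (?\<tau> b))"
  have p0: "p > 0" and rp: "r < p" using p r by auto
  have a: "?a \<in> {1, -1}" by (cases "even (n - 1)") auto
  have pos: "?\<tau> ` Wbasis p r n = {..D}" by (rule chain_pos_image[OF r(1) rp n D])
  then have le: "?\<tau> b \<le> D" if "b \<in> Wbasis p r n" for b using that by auto
  \<comment> \<open>This puts every block boundary in the case where \<open>E\<close> is normalised
    to 1, so that neighbouring blocks are joined.\<close>
  have ndD: "\<not> p dvd D + 1" using r rp D by (auto dest: dvd_imp_le)
  have dvd_iff: "p dvd i * p + k \<longleftrightarrow> p dvd k" for i k by simp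
  have nd: "\<not> p dvd i * p + k" if "0 < k" "k < p" for i k
    using that dvd_iff by (auto dest: dvd_imp_le)
  show ?thesis
    unfolding A_deg_eq degree_monomials
  proof (rule sub_iso_chainI[OF p U_module_Wmod[OF p a r], where \<tau> = ?\<tau> and D = D])
    show "car (Wmod p ?a r n) = cvec.span (bvec ` Wbasis p r n)"
      "actE (Wmod p ?a r n) = linext (WE p ?a r n)" "actF (Wmod p ?a r n) = linext (WF p ?a r n)"
      "actK (Wmod p ?a r n) = linext (\<lambda>b. Wwt p ?a r b *\<^sub>C bvec b)"
      by (simp_all add: Wmod_def)
    show "inj_on ?\<tau> (Wbasis p r n)" using rp by (intro chain_pos_inj) simp
    show "(\<lambda>t. (D - t, t)) ` {..D} = (\<lambda>b. (D - ?\<tau> b, ?\<tau> b)) ` Wbasis p r n"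
      by (simp add: image_image flip: pos)
    show "actE (qplane p) (chain_vec p D (?\<tau> b)) = ?h (WE p ?a r n b)" if b: "b \<in> Wbasis p r n" for b
    proof (cases b)
      case (Top j k)
      then have jk: "1 \<le> j" "j \<le> n" "k < r" using b by (auto simp: Wbasis_def)
      show ?thesis
      proof (cases k)
        case (Suc l)
        then show ?thesis
          using le[OF b] Top jk rp nd[of "Suc l" "j - 1"] chain_coeff[OF p0 D, of "j - 1" l]
          by (simp add: actE_chain_vec_Suc[OF p] linext_scale ac_simps)
      next
        case 0
        show ?thesis
        proof (cases "2 \<le> j")
          case True
          then obtain j' where j': "j = Suc (Suc j')" by (metis Suc_le_D numeral_2_eq_2 Suc_le_mono)
          obtain s where s: "p = Suc s" using p0 gr0_implies_Suc by blast
          \<comment> \<open>The first vector of a later top copy sits at a multiple of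
            \<open>p\<close>; one step down is the end of the preceding socle copy.\<close>
          have *: "(j - 1) * p = Suc (j' * p + s)" by (simp add: j' s)
          moreover have "p dvd Suc (j' * p + s)" unfolding *[symmetric] by simp
          moreover have "j' * p + s = ?\<tau> (Soc (j - 1) (p - r - 1))" using rp by (simp add: j' s)
          ultimately show ?thesis
            using True le[OF b] Top 0 ndD by (simp add: actE_chain_vec_Suc[OF p])
        qed (use Top 0 jk in \<open>simp add: actE_chain_vec_0\<close>)
      qed
    next
      case (Soc j k)
      then have jk: "1 \<le> j" "j \<le> n - 1" "k < p - r" using b by (auto simp: Wbasis_def)
      obtain s where s: "r = Suc s" using r gr0_implies_Suc[of r] by auto
      \<comment> \<open>At the offset \<open>s + k = r + k - 1\<close> the chain coefficient is
        \<open>[r + k] [- k]\<close> up to the sign \<open>?a\<close>. Reflection turns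
        \<open>[r + k]\<close> into \<open>[p - r - k]\<close>, and oddness of \<open>[- k]\<close>
        gives the opposite sign of the socle. For \<open>k = 0\<close> it vanishes, so no
        \<open>E\<close> leaves the start of a socle copy.\<close>
      have coeff: "qint p (int ((j - 1) * p + (s + k)) + 1) * qint p (int D - int ((j - 1) * p + (s + k))) =
          - ?a * qint p (int k) * qint p (int p - int r - int k)"
        using chain_coeff[OF p0 D, of "j - 1" "s + k"] jk
          qint_p_minus[OF p0, of "int r + int k"] qint_minus[of p "int k"]
        by (simp add: s algebra_simps)
      have E: "actE (qplane p) (chain_vec p D (?\<tau> b)) =
          (- ?a * qint p (int k) * qint p (int p - int r - int k)) *\<^sub>C chain_vec p D ((j - 1) * p + (s + k))"
        using coeff le[OF b] Soc jk rp nd[of "r + k" "j - 1"]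
        by (simp add: s actE_chain_vec_Suc[OF p])
      show ?thesis
        unfolding E using Soc by (cases k) (simp_all add: s linext_scale linext_minus)
    qed
    show "actF (qplane p) (chain_vec p D (?\<tau> b)) = ?h (WF p ?a r n b)" if b: "b \<in> Wbasis p r n" for b
    proof (cases b)
      case (Top j k)
      then have jk: "1 \<le> j" "j \<le> n" "k < r" using b by (auto simp: Wbasis_def)
      have ndk: "\<not> p dvd Suc ((j - 1) * p + k)" using nd[of "Suc k" "j - 1"] jk rp by simp
      show ?thesis
      proof (cases "k + 1 < r \<or> j < n")
        case True
        \<comment> \<open>Only the last vector of the copy \<open>j = n\<close> sits at the end of
          the chain.\<close>
        have "(j - 1) * p + k \<noteq> D"
        proof (cases "j < n")
          case True
          then have "j - 1 + 1 \<le> n - 1" using jk by simp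
          then have "(j - 1 + 1) * p \<le> (n - 1) * p" by (rule mult_le_mono1)
          then show ?thesis using D jk rp r unfolding distrib_right by linarith
        next
          case False
          then show ?thesis using True D jk by simp
        qed
        moreover have "Suc k = r" if "\<not> Suc k < r" using that jk by simp
        ultimately show ?thesis using True ndk le[OF b] Top by (auto simp: actF_chain_vec[OF p])
      next
        case False
        then have "(j - 1) * p + k = D" using D jk by simp
        then show ?thesis using False Top by (simp add: actF_chain_vec[OF p])
      qed
    next
      case (Soc j k)
      then have jk: "1 \<le> j" "j \<le> n - 1" "k < p - r" using b by (auto simp: Wbasis_def)
      then have "(j - 1 + 1) * p \<le> (n - 1) * p" by (intro mult_le_mono1) simp
      then have D': "(j - 1) * p + (r + k) \<noteq> D"
        using D jk r unfolding distrib_right by linarith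
      show ?thesis
      proof (cases "k + 1 < p - r")
        case True
        then show ?thesis
          using D' le[OF b] Soc nd[of "r + Suc k" "j - 1"] by (simp add: actF_chain_vec[OF p])
      next
        case False
        then have "Suc ((j - 1) * p + (r + k)) = (j - 1) * p + p" using jk by simp
        \<comment> \<open>A socle copy ends just before a multiple of \<open>p\<close>, where
          \<open>F\<close> vanishes.\<close>
        then have "p dvd Suc ((j - 1) * p + (r + k))" by (metis dvd_add dvd_refl dvd_triv_right)
        then show ?thesis using False le[OF b] Soc by (simp add: actF_chain_vec[OF p])
      qed
    qed
    show "q p powi (int D - 2 * int (?\<tau> b)) = Wwt p ?a r b" if b: "b \<in> Wbasis p r n" for b
    proof (cases b)
      case (Top j k)
      then show ?thesis using chain_weight[OF p0 D, of "j - 1" k] by simp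
    next
      case (Soc j k)
      \<comment> \<open>The socle weight is the top weight continued to the offset
        \<open>r + k\<close>; the extra \<open>p\<close> in the exponent accounts for the
        sign.\<close>
      have "q p powi (int p - int r - 1 - 2 * int k) = - (q p powi (int r - 1 - 2 * int (r + k)))"
        using q_powi_mult_p[OF p0, of 1 "int r - 1 - 2 * int (r + k)"] by (simp add: algebra_simps)
      then show ?thesis using chain_weight[OF p0 D, of "j - 1" "r + k"] Soc by simp
    qed
  qed (use le in \<open>auto simp: Wmod_def\<close>)
qed

section \<open>The decomposition\<close>

text \<open>All generators preserve the total degree, so any set of monomials made up of full
  degrees spans a submodule.\<close>

lemma U_submodule_monomials:
  assumes p: "p \<ge> 2" and P: "\<And>m n m' n'. m + n = m' + n' \<Longrightarrow> (m, n) \<in> T \<Longrightarrow> (m', n') \<in> T"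
  shows "U_submodule p (qplane p) (cvec.span (bvec ` T))"
proof (rule U_submoduleI[OF U_module_qplane[OF p]])
  note sp = linext_span[of T]
  have *: "c *\<^sub>C mon m' n' \<in> cvec.span (bvec ` T)" if "(m, n) \<in> T" "m' + n' = m + n" for c m n m' n'
    using P[of m n m' n'] that by (intro cvec.span_scale cvec.span_base imageI) simp
  show "actE (qplane p) v \<in> cvec.span (bvec ` T)" if "v \<in> cvec.span (bvec ` T)" for v
    using that by (auto simp: qplane_def cvec.span_zero intro!: sp *)
  show "actF (qplane p) v \<in> cvec.span (bvec ` T)" if "v \<in> cvec.span (bvec ` T)" for v
    using that by (auto simp: qplane_def cvec.span_zero intro!: sp *)
  show "actK (qplane p) v \<in> cvec.span (bvec ` T)" if "v \<in> cvec.span (bvec ` T)" for v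
    using that by (auto simp: qplane_def cvec.span_zero intro!: sp *)
  show "actKi (qplane p) v \<in> cvec.span (bvec ` T)" if "v \<in> cvec.span (bvec ` T)" for v
    using that by (auto simp: qplane_def cvec.span_zero intro!: sp *)
qed (auto simp: cvec.subspace_span qplane_def)

section \<open>Partition of the monomials among the summands\<close>

fun summand_monomials :: "nat \<Rightarrow> nat \<Rightarrow> summand \<Rightarrow> (nat \<times> nat) set"
  where
    "summand_monomials p n Lower = {(m, l). m + l \<le> (n - 1) * p - 1}"
  | "summand_monomials p n (Zigzag r) = {(m, l). m + l = (n - 1) * p + r - 1}"
  | "summand_monomials p n (Irred k) =
      (\<lambda>l. (n * p - 1 - ((k - 1) * p + l), (k - 1) * p + l)) ` {..<p}"

text \<open>Describes the block by the quotient \<open>t div p\<close>, from which the label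
  \<open>k\<close> can be read off; for \<open>p = 0\<close> the block is empty, hence the last
  conjunct.\<close>

lemma Irred_monomials:
  assumes "1 \<le> k" "k \<le> n"
  shows "summand_monomials p n (Irred k) = {(m, t). m + t + 1 = n * p \<and> t div p = k - 1 \<and> p > 0}"
proof -
  have "(k - 1 + 1) * p \<le> n * p" using assms by (intro mult_le_mono1) simp
  then have kn: "(k - 1) * p + l < n * p" if "l < p" for l using that by (simp only: distrib_right)
  show ?thesis
  proof (intro equalityI subsetI)
    fix x assume "x \<in> summand_monomials p n (Irred k)"
    then obtain l where "x = (n * p - 1 - ((k - 1) * p + l), (k - 1) * p + l)" "l < p" by auto
    then show "x \<in> {(m, t). m + t + 1 = n * p \<and> t div p = k - 1 \<and> p > 0}" using kn[of l] by auto
  next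
    fix x assume "x \<in> {(m, t). m + t + 1 = n * p \<and> t div p = k - 1 \<and> p > 0}"
    then obtain m t where x: "x = (m, t)" "m + t + 1 = n * p" "t div p = k - 1" "p > 0" by auto
    then have "t = (k - 1) * p + t mod p" by (metis div_mult_mod_eq)
    then show "x \<in> summand_monomials p n (Irred k)" using x
      by (auto intro!: image_eqI[of _ _ "t mod p"])
  qed
qed

lemma summand_monomials_Un:
  assumes p: "p \<ge> 2" and n: "n \<ge> 2"
  shows "(\<Union>i\<in>{Lower} \<union> Zigzag ` {1..p-1} \<union> Irred ` {1..n}. summand_monomials p n i) =
    {(m, l). m + l \<le> n * p - 1}"
proof -
  obtain c where c: "n = Suc (Suc c)" using n by (metis Suc_le_D numeral_2_eq_2 Suc_le_mono)
  show ?thesis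
  proof (intro equalityI subsetI)
    fix x assume "x \<in> (\<Union>i\<in>{Lower} \<union> Zigzag ` {1..p-1} \<union> Irred ` {1..n}. summand_monomials p n i)"
    then consider "x \<in> summand_monomials p n Lower"
      | r where "r \<in> {1..p-1}" "x \<in> summand_monomials p n (Zigzag r)"
      | k where "k \<in> {1..n}" "x \<in> summand_monomials p n (Irred k)" by blast
    then show "x \<in> {(m, l). m + l \<le> n * p - 1}"
    proof cases
      case (3 k)
      then have "x \<in> {(m, t). m + t + 1 = n * p \<and> t div p = k - 1 \<and> p > 0}"
        using Irred_monomials[of k n p] by auto
      then show ?thesis by auto
    qed (use p in \<open>auto simp: c\<close>)
  next
    fix x assume "x \<in> {(m, l). m + l \<le> n * p - 1}"
    then obtain m l where x: "x = (m, l)" "m + l \<le> n * p - 1" by auto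
    \<comment> \<open>The degrees split into those of \<open>Lower\<close>, the \<open>p - 1\<close>
      zigzag degrees and the top degree \<open>n * p - 1\<close>.\<close>
    consider "m + l \<le> (n - 1) * p - 1" | "m + l \<ge> (n - 1) * p" "m + l < n * p - 1" | "m + l + 1 = n * p"
      using x by (fastforce simp: c)
    then show "x \<in> (\<Union>i\<in>{Lower} \<union> Zigzag ` {1..p-1} \<union> Irred ` {1..n}. summand_monomials p n i)"
    proof cases
      case 1
      then show ?thesis using x by auto
    next
      case 2
      define r where "r = m + l + 1 - (n - 1) * p"
      have "r \<in> {1..p-1}" "x \<in> summand_monomials p n (Zigzag r)"
        using 2 x by (auto simp: r_def c)
      then show ?thesis by blast
    next
      case 3
      have "l div p < n" using 3 p by (intro less_mult_imp_div_less) simp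
      moreover have "x \<in> summand_monomials p n (Irred (l div p + 1))"
        using calculation 3 x p by (subst Irred_monomials) auto
      ultimately show ?thesis by (intro UN_I[of "Irred (l div p + 1)"]) auto
    qed
  qed
qed

text \<open>A monomial determines its summand: \<open>label\<close> computes it from the degree and,
  in the top degree, from the exponent of \<open>y\<close>.\<close>

lemma summand_monomials_disjoint:
  assumes p: "p \<ge> 2" and n: "n \<ge> 2"
  shows "disjoint_family_on (summand_monomials p n) ({Lower} \<union> Zigzag ` {1..p-1} \<union> Irred ` {1..n})"
proof -
  obtain c where c: "n = Suc (Suc c)" using n by (metis Suc_le_D numeral_2_eq_2 Suc_le_mono)
  define label where "label = (\<lambda>(m, t). if m + t \<le> (n - 1) * p - 1 then Lower
      else if m + t + 1 = n * p then Irred (t div p + 1) else Zigzag (m + t + 1 - (n - 1) * p))"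
  have label: "label x = i"
    if ix: "i \<in> {Lower} \<union> Zigzag ` {1..p-1} \<union> Irred ` {1..n}" "x \<in> summand_monomials p n i" for i x
  proof -
    consider "i = Lower" | r where "i = Zigzag r" "r \<in> {1..p-1}" | k where "i = Irred k" "k \<in> {1..n}"
      using ix by blast
    then show ?thesis
    proof cases
      case (3 k)
      then have "x \<in> {(m, t). m + t + 1 = n * p \<and> t div p = k - 1 \<and> p > 0}"
        using Irred_monomials[of k n p] ix by auto
      then show ?thesis using 3 by (auto simp: label_def c)
    qed (use ix p in \<open>auto simp: label_def c\<close>)
  qed
  show ?thesis unfolding disjoint_family_on_def
  proof (intro ballI impI equals0I)
    fix i j x
    assume "i \<in> {Lower} \<union> Zigzag ` {1..p-1} \<union> Irred ` {1..n}"
      "j \<in> {Lower} \<union> Zigzag ` {1..p-1} \<union> Irred ` {1..n}" "i \<noteq> j"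
      and x: "x \<in> summand_monomials p n i \<inter> summand_monomials p n j"
    then show False using label[of i x] label[of j x] by (metis IntD1 IntD2)
  qed
qed

lemma A_upto_decomposition:
  assumes p: "p \<ge> 2" and n: "n \<ge> 2" and a: "a = (if odd n then 1 else -1)"
  shows "\<exists>S. S Lower = A_upto ((n - 1) * p - 1) \<and>
    (\<forall>r\<in>{1..p-1}. sub_iso p (S (Zigzag r)) (Wmod p a r n) \<and> S (Zigzag r) \<subseteq> A_deg ((n - 1) * p + r - 1)) \<and>
    (\<forall>k\<in>{1..n}. sub_iso p (S (Irred k)) (Xmod p a p) \<and> S (Irred k) \<subseteq> A_deg (n * p - 1)) \<and>
    direct_sum (A_upto (n * p - 1)) ({Lower} \<union> Zigzag ` {1..p-1} \<union> Irred ` {1..n}) S"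
proof -
  define S where "S = (\<lambda>i. cvec.span (bvec ` summand_monomials p n i))"
  have a': "a = (-1) ^ (n - 1)" using a n by auto
  have "S Lower = A_upto ((n - 1) * p - 1)" by (simp add: S_def A_upto_eq)
  moreover have Z: "S (Zigzag r) = A_deg ((n - 1) * p + r - 1)" for r
    by (simp add: S_def A_deg_eq)
  moreover have "sub_iso p (S (Zigzag r)) (Wmod p a r n)" if "r \<in> {1..p-1}" for r
    unfolding Z a' by (rule sub_iso_Wmod) (use that p n in auto)
  moreover have "sub_iso p (S (Irred k)) (Xmod p a p)" if "k \<in> {1..n}" for k
  proof -
    \<comment> \<open>The top degree is the case \<open>r = p\<close> with \<open>c = n - 1\<close>;
      the label \<open>k\<close> counts from 1, the blocks from 0.\<close>
    have "n * p - 1 + 1 = (n - 1) * p + p" using p n by (cases n) auto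
    then show ?thesis
      unfolding S_def summand_monomials.simps a'
      using sub_iso_Xmod[OF p, of p "n * p - 1" "n - 1" "k - 1"] p that by auto
  qed
  moreover have "S (Irred k) \<subseteq> A_deg (n * p - 1)" if "k \<in> {1..n}" for k
    unfolding S_def A_deg_eq
    by (intro cvec.span_mono image_mono, subst Irred_monomials) (use that in auto)
  moreover have "direct_sum (A_upto (n * p - 1)) ({Lower} \<union> Zigzag ` {1..p-1} \<union> Irred ` {1..n}) S"
    by (rule direct_sum_span_bvec[OF _ summand_monomials_disjoint[OF p n]])
      (simp_all only: summand_monomials_Un[OF p n] A_upto_eq S_def, simp)
  ultimately show ?thesis by (intro exI[of _ S] conjI ballI) simp_all
qed

text \<open>In degrees below \<open>p\<close> the whole chain is one block, so each graded piece is
  itself irreducible.\<close>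

lemma A_upto_bottom_decomposition:
  assumes p: "p \<ge> 2"
  shows "(\<forall>r\<in>{1..p}. sub_iso p (A_deg (r - 1)) (Xmod p 1 r)) \<and>
    direct_sum (A_upto (p - 1)) {1..p} (\<lambda>r. A_deg (r - 1))"
proof (intro conjI ballI)
  fix r assume r: "r \<in> {1..p}"
  then have "{..r - 1} = {..<r}" by auto
  then have "A_deg (r - 1) = cvec.span (bvec ` (\<lambda>k. (r - 1 - (0 * p + k), 0 * p + k)) ` {..<r})"
    by (simp add: A_deg_eq degree_monomials)
  then show "U_submodule p (qplane p) (A_deg (r - 1))" "U_iso ((qplane p)\<lparr>car := A_deg (r - 1)\<rparr>) (Xmod p 1 r)"
    using sub_iso_Xmod[OF p, of r "r - 1" 0 0] r by simp_all
next
  have "{(m, l). m + l \<le> p - 1} = (\<Union>r\<in>{1..p}. {(m, l). m + l = r - 1})"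
  proof (intro equalityI subsetI)
    fix x assume "x \<in> {(m, l). m + l \<le> p - 1}"
    then show "x \<in> (\<Union>r\<in>{1..p}. {(m, l). m + l = r - 1})"
      using p by (intro UN_I[of "fst x + snd x + 1"]) auto
  qed auto
  then show "direct_sum (A_upto (p - 1)) {1..p} (\<lambda>r. A_deg (r - 1))"
    by (intro direct_sum_span_bvec[where T = "\<lambda>r. {(m, l). m + l = r - 1}"])
      (auto simp: A_upto_eq A_deg_eq disjoint_family_on_def)
qed

theorem lemma2p3p1:
  fixes p :: nat
  assumes "p \<ge> 2"
  shows
    "(\<forall>i. U_submodule p (qplane p) (A_deg i)) \<and>
     (\<forall>i. U_submodule p (qplane p) (A_upto i)) \<and>
     (\<forall>i. direct_sum (A_upto i) {0..i} A_deg) \<and>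
     (\<exists>X. (\<forall>r\<in>{1..p}. sub_iso p (X r) (Xmod p 1 r) \<and> X r \<subseteq> A_deg (r - 1)) \<and>
       direct_sum (A_upto (p - 1)) {1..p} X) \<and>
     (\<exists>S. S Lower = A_upto (p - 1) \<and>
       (\<forall>r\<in>{1..p-1}. sub_iso p (S (Zigzag r)) (Wmod p (-1) r 2) \<and>
          S (Zigzag r) \<subseteq> A_deg (p + r - 1)) \<and>
       (\<forall>k\<in>{1..2}. sub_iso p (S (Irred k)) (Xmod p (-1) p) \<and>
          S (Irred k) \<subseteq> A_deg (2 * p - 1)) \<and>
       direct_sum (A_upto (2 * p - 1)) ({Lower} \<union> Zigzag ` {1..p-1} \<union> Irred ` {1..2}) S) \<and>
     (\<forall>n\<ge>2. \<exists>S. S Lower = A_upto ((n - 1) * p - 1) \<and>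
       (\<forall>r\<in>{1..p-1}. sub_iso p (S (Zigzag r)) (Wmod p (if odd n then 1 else -1) r n)) \<and>
       (\<forall>k\<in>{1..n}. sub_iso p (S (Irred k)) (Xmod p (if odd n then 1 else -1) p)) \<and>
       direct_sum (A_upto (n * p - 1)) ({Lower} \<union> Zigzag ` {1..p-1} \<union> Irred ` {1..n}) S)"
proof -
  have "U_submodule p (qplane p) (A_deg i)" for i
    unfolding A_deg_eq by (rule U_submodule_monomials[OF assms]) auto
  moreover have "U_submodule p (qplane p) (A_upto i)" for i
    unfolding A_upto_eq by (rule U_submodule_monomials[OF assms]) auto
  moreover have "direct_sum (A_upto i) {0..i} A_deg" for i
    by (rule direct_sum_span_bvec[where T = "\<lambda>j. {(m, l). m + l = j}"])
      (auto simp: A_upto_eq A_deg_eq disjoint_family_on_def intro!: arg_cong[of _ _ cvec.span])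
  moreover have "\<exists>X. (\<forall>r\<in>{1..p}. sub_iso p (X r) (Xmod p 1 r) \<and> X r \<subseteq> A_deg (r - 1)) \<and>
      direct_sum (A_upto (p - 1)) {1..p} X"
    using A_upto_bottom_decomposition[OF assms] by (intro exI[of _ "\<lambda>r. A_deg (r - 1)"]) simp
  \<comment> \<open>The case \<open>n = 2\<close> is stated separately since it also locates the
    summands in their degrees.\<close>
  moreover have "\<exists>S. S Lower = A_upto (p - 1) \<and>
      (\<forall>r\<in>{1..p-1}. sub_iso p (S (Zigzag r)) (Wmod p (-1) r 2) \<and> S (Zigzag r) \<subseteq> A_deg (p + r - 1)) \<and>
      (\<forall>k\<in>{1..2}. sub_iso p (S (Irred k)) (Xmod p (-1) p) \<and> S (Irred k) \<subseteq> A_deg (2 * p - 1)) \<and>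
      direct_sum (A_upto (2 * p - 1)) ({Lower} \<union> Zigzag ` {1..p-1} \<union> Irred ` {1..2}) S"
    using A_upto_decomposition[OF assms, of 2 "-1"] by simp
  moreover have "\<exists>S. S Lower = A_upto ((n - 1) * p - 1) \<and>
      (\<forall>r\<in>{1..p-1}. sub_iso p (S (Zigzag r)) (Wmod p (if odd n then 1 else -1) r n)) \<and>
      (\<forall>k\<in>{1..n}. sub_iso p (S (Irred k)) (Xmod p (if odd n then 1 else -1) p)) \<and>
      direct_sum (A_upto (n * p - 1)) ({Lower} \<union> Zigzag ` {1..p-1} \<union> Irred ` {1..n}) S"
    if "n \<ge> 2" for n
    using A_upto_decomposition[OF assms that refl] by blast
  ultimately show ?thesis by (intro conjI allI impI)
qed

end
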